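(* Let $n\ge d$, $L=\{\ell_1,\dots,\ell_n\}$, $R=\{r_1,\dots,r_d\}$. (i) If $\mathcal{M}$ is a linkage $(n,d)$-matching field on $L\sqcup R$, then the set of maximal topes that are compatible with every matching of $\mathcal{M}$ forms an $(n,d)$-tope arrangement. (ii) If $\mathcal{A}$ is an $(n,d)$-tope arrangement, then for every $d$-subset $\sigma\subseteq L$ there is exactly one perfect matching $M_\sigma$ between $\sigma$ and $R$ contained in some tope of $\mathcal{A}$, and the family $(M_\sigma)_\sigma$ of all these maximal matchings is a linkage $(n,d)$-matching field. Thus linkage $(n,d)$-matching fields and $(n,d)$-tope arrangements are cryptomorphic.
   Context: Graphs are bipartite graphs on $L\sqcup R$ identified with edge sets; left/right degree vectors are $(\deg\ell_1,\dots,\deg\ell_n)$ and $(\deg r_1,\dots,\deg r_d)$. A maximal tope is a graph whose left degree vector is all ones and whose right degree vector has all entries positive. Two graphs $F_1,F_2$ are compatible if for all $J\subseteq L$, $I\subseteq R$ such that both contain a perfect matching between $J$ and $I$ (as a subgraph), these perfect matchings are equal. An $(n,d)$-matching field $\mathcal{M}=(M_\sigma)$ assigns to each $d$-subset $\sigma\subseteq L$ a perfect matching $M_\sigma$ between $\sigma$ and $R$; it is linkage if for every $r_i\in R$ and every $(d+1)$-subset $\tau\subseteq L$ there exist distinct $\ell_j,\ell_{j'}\in\tau$ such that $M_{\tau\setminus\{\ell_j\}}$ and $M_{\tau\setminus\{\ell_{j'}\}}$ agree everywhere except on the edges incident with $r_i$. An $(n,d)$-tope arrangement is a set of pairwise compatible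 maximal topes in bijection with the lattice points $\{w\in\mathbb{Z}_{\ge0}^d:\sum w_i=n-d\}$ via the map sending a tope with right degree vector $v$ to $v-(1,\dots,1)$ (i.e. exactly one tope for each $v\in\mathbb{Z}_{>0}^d$ with $\sum v_i=n$). *)

theory Defs
  imports Main
begin

text \<open>Left vertices are 0..<n (standing for l_1..l_n), right vertices are 0..<d
  (standing for r_1..r_d). A bipartite graph on L \<sqcup> R is identified with its
  edge set, a set of pairs (left vertex, right vertex).\<close>

definition bgraph :: "nat \<Rightarrow> nat \<Rightarrow> (nat \<times> nat) set \<Rightarrow> bool" where
  "bgraph n d G \<longleftrightarrow> G \<subseteq> {0..<n} \<times> {0..<d}"

definition ldeg :: "(nat \<times> nat) set \<Rightarrow> nat \<Rightarrow> nat" where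
  "ldeg G l = card {r. (l, r) \<in> G}"

definition rdeg :: "(nat \<times> nat) set \<Rightarrow> nat \<Rightarrow> nat" where
  "rdeg G r = card {l. (l, r) \<in> G}"

definition rdeg_vec :: "nat \<Rightarrow> (nat \<times> nat) set \<Rightarrow> nat \<Rightarrow> nat" where
  "rdeg_vec d G = (\<lambda>i. if i < d then rdeg G i else 0)"

definition maximal_tope :: "nat \<Rightarrow> nat \<Rightarrow> (nat \<times> nat) set \<Rightarrow> bool" where
  "maximal_tope n d F \<longleftrightarrow> bgraph n d F \<and> (\<forall>l<n. ldeg F l = 1) \<and> (\<forall>r<d. rdeg F r > 0)"

definition perfect_matching :: "nat set \<Rightarrow> nat set \<Rightarrow> (nat \<times> nat) set \<Rightarrow> bool" where
  "perfect_matching J I M \<longleftrightarrow> M \<subseteq> J \<times> I \<and>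
     (\<forall>j\<in>J. \<exists>!i. (j, i) \<in> M) \<and> (\<forall>i\<in>I. \<exists>!j. (j, i) \<in> M)"

definition compatible :: "nat \<Rightarrow> nat \<Rightarrow> (nat \<times> nat) set \<Rightarrow> (nat \<times> nat) set \<Rightarrow> bool" where
  "compatible n d F1 F2 \<longleftrightarrow>
     (\<forall>J I M1 M2. J \<subseteq> {0..<n} \<and> I \<subseteq> {0..<d} \<and>
        perfect_matching J I M1 \<and> M1 \<subseteq> F1 \<and>
        perfect_matching J I M2 \<and> M2 \<subseteq> F2 \<longrightarrow> M1 = M2)"

definition dsubset :: "nat \<Rightarrow> nat \<Rightarrow> nat set \<Rightarrow> bool" where
  "dsubset n k \<sigma> \<longleftrightarrow> \<sigma> \<subseteq> {0..<n} \<and> card \<sigma> = k"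

text \<open>An (n,d)-matching field: a matching for every d-subset of L (values at other
  sets are irrelevant).\<close>
definition matching_field :: "nat \<Rightarrow> nat \<Rightarrow> (nat set \<Rightarrow> (nat \<times> nat) set) \<Rightarrow> bool" where
  "matching_field n d M \<longleftrightarrow> (\<forall>\<sigma>. dsubset n d \<sigma> \<longrightarrow> perfect_matching \<sigma> {0..<d} (M \<sigma>))"

definition linkage :: "nat \<Rightarrow> nat \<Rightarrow> (nat set \<Rightarrow> (nat \<times> nat) set) \<Rightarrow> bool" where
  "linkage n d M \<longleftrightarrow> matching_field n d M \<and>
     (\<forall>i<d. \<forall>\<tau>. dsubset n (d + 1) \<tau> \<longrightarrow>
        (\<exists>j\<in>\<tau>. \<exists>j'\<in>\<tau>. j \<noteq> j' \<and>
           {e \<in> M (\<tau> - {j}). snd e \<noteq> i} = {e \<in> M (\<tau> - {j'}). snd e \<noteq> i}))"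

text \<open>Lattice points v \<in> Z_{>0}^d with sum n (i.e. w = v - 1 ranges over the
  points of Z_{\<ge>0}^d with sum n - d), as functions supported on 0..<d.\<close>
definition pos_points :: "nat \<Rightarrow> nat \<Rightarrow> (nat \<Rightarrow> nat) set" where
  "pos_points n d = {v. (\<forall>i<d. v i > 0) \<and> (\<forall>i\<ge>d. v i = 0) \<and> (\<Sum>i<d. v i) = n}"

definition tope_arrangement :: "nat \<Rightarrow> nat \<Rightarrow> (nat \<times> nat) set set \<Rightarrow> bool" where
  "tope_arrangement n d A \<longleftrightarrow>
     (\<forall>F\<in>A. maximal_tope n d F) \<and>
     (\<forall>F1\<in>A. \<forall>F2\<in>A. compatible n d F1 F2) \<and>
     bij_betw (rdeg_vec d) A (pos_points n d)"

end

theory Submission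
  imports Defs
begin

text \<open>The linkage axiom makes the matchings of the \<open>d\<close>-subsets of a \<open>(d + 1)\<close>-subset \<open>\<tau>\<close> the
  orientations of one tree on \<open>\<tau>\<close>, whose edges are labelled by \<open>R\<close>: the matching of
  \<open>\<tau> - {a}\<close> sends each edge to its end far from \<open>a\<close>.

  Compatibility of any two matchings of a linkage field follows by a descent. If \<open>M\<^sub>\<sigma>\<close> and
  \<open>M\<^sub>\<sigma>\<^sub>'\<close> disagree on a common \<open>J\<close>, matched to \<open>I\<close>, with \<open>\<sigma> \<union> \<sigma>'\<close> minimal, exchange the elements of
  \<open>\<sigma>\<close> one at a time for those of \<open>\<sigma>' - \<sigma>\<close>. Always drop the element nearest in the tree to the
  inserted one among those missed, along with everything dropped so far, by a set whose matching
  agrees with \<open>M\<^sub>\<sigma>\<^sub>'\<close> on \<open>I\<close>. Then \<open>I\<close> is never matched to such an element, which the last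
  exchange contradicts.

  Topes of all types arise by splitting right vertices: attaching both ends of the tree edge of
  \<open>i\<close> to two copies of \<open>i\<close> gives a linkage field with \<open>d + 1\<close> right vertices, and after
  \<open>n - d\<close> splittings the matching of \<open>L\<close> itself is a tope all of whose transversal matchings
  belong to the original field.

  Conversely, a tope arrangement restricts to every subset of \<open>L\<close> of size at least \<open>d\<close>. On
  \<open>d\<close>-subsets this yields the matchings, and on \<open>(d + 1)\<close>-subsets the linkage axiom.\<close>

subsection \<open>Linkage trees\<close>

text \<open>\<open>W \<sigma> k\<close> is the left vertex that the matching of \<open>\<sigma>\<close> pairs with the right vertex \<open>k\<close>.\<close>

locale linkage_field =
  fixes L :: "'a::linorder set" and d :: nat and W :: "'a set \<Rightarrow> nat \<Rightarrow> 'a"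
  assumes finL: "finite L"
    and bij: "\<lbrakk>\<sigma> \<subseteq> L; card \<sigma> = d\<rbrakk> \<Longrightarrow> bij_betw (W \<sigma>) {..<d} \<sigma>"
    and link: "\<lbrakk>\<tau> \<subseteq> L; card \<tau> = Suc d; i < d\<rbrakk> \<Longrightarrow>
      \<exists>a\<in>\<tau>. \<exists>b\<in>\<tau>. a \<noteq> b \<and> (\<forall>k<d. k \<noteq> i \<longrightarrow> W (\<tau> - {a}) k = W (\<tau> - {b}) k)"
begin

text \<open>Kept as a relation, since the linkage axiom only gives existence;
  \<open>ends_edge\<close> later shows that all edges of \<tau> with label \<open>i\<close> have the
  same two ends.\<close>

definition edge :: "'a set \<Rightarrow> nat \<Rightarrow> 'a \<Rightarrow> 'a \<Rightarrow> bool" where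
  "edge \<tau> i a b \<longleftrightarrow> i < d \<and> a \<in> \<tau> \<and> b \<in> \<tau> \<and> a \<noteq> b \<and>
     (\<forall>k<d. k \<noteq> i \<longrightarrow> W (\<tau> - {a}) k = W (\<tau> - {b}) k)"

lemma edge_sym: "edge \<tau> i a b \<Longrightarrow> edge \<tau> i b a"
  unfolding edge_def by auto

lemma bij_minus:
  assumes "\<tau> \<subseteq> L" "card \<tau> = Suc d" "a \<in> \<tau>"
  shows "bij_betw (W (\<tau> - {a})) {..<d} (\<tau> - {a})"
  using assms finL by (intro bij) (auto simp: card_Diff_singleton finite_subset)

lemma W_in:
  assumes "\<tau> \<subseteq> L" "card \<tau> = Suc d" "a \<in> \<tau>" "k < d"
  shows "W (\<tau> - {a}) k \<in> \<tau> - {a}"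
  using bij_minus[OF assms(1-3)] assms(4) by (auto simp: bij_betw_def)

lemma W_inj:
  assumes "\<tau> \<subseteq> L" "card \<tau> = Suc d" "a \<in> \<tau>" "k < d" "k' < d"
    and "W (\<tau> - {a}) k = W (\<tau> - {a}) k'"
  shows "k = k'"
  using bij_minus[OF assms(1-3)] assms(4-) by (auto simp: bij_betw_def inj_on_def)

lemma W_surj:
  assumes "\<tau> \<subseteq> L" "card \<tau> = Suc d" "a \<in> \<tau>" "z \<in> \<tau>" "z \<noteq> a"
  obtains k where "k < d" "W (\<tau> - {a}) k = z"
proof -
  have "z \<in> W (\<tau> - {a}) ` {..<d}"
    using bij_minus[OF assms(1-3)] assms(4,5) by (auto simp: bij_betw_def)
  then show thesis using that by auto
qed

text \<open>The matching of \<tau> - {a} covers \<open>b\<close>. If it did so at a right vertex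
  other than \<open>i\<close>, the matching of \<tau> - {b} would agree there and use the vertex it
  leaves out.\<close>

lemma edge_W:
  assumes "\<tau> \<subseteq> L" "card \<tau> = Suc d" "edge \<tau> i a b"
  shows "W (\<tau> - {a}) i = b"
proof (rule ccontr)
  have e: "i < d" "a \<in> \<tau>" "b \<in> \<tau>" "a \<noteq> b"
    "\<And>k. k < d \<Longrightarrow> k \<noteq> i \<Longrightarrow> W (\<tau> - {a}) k = W (\<tau> - {b}) k"
    using assms(3) by (auto simp: edge_def)
  assume "W (\<tau> - {a}) i \<noteq> b"
  moreover obtain k where k: "k < d" "W (\<tau> - {a}) k = b"
    using W_surj[OF assms(1,2) e(2,3)] e(4) by metis
  ultimately have "k \<noteq> i" by auto
  then have "W (\<tau> - {b}) k = b" using e k by metis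
  then show False using W_in[OF assms(1,2) e(3) k(1)] by auto
qed

lemma edge_ex:
  assumes "\<tau> \<subseteq> L" "card \<tau> = Suc d" "i < d"
  obtains a b where "edge \<tau> i a b"
  using link[OF assms] assms(3) unfolding edge_def by blast

definition adj :: "(nat \<Rightarrow> 'a \<times> 'a) \<Rightarrow> ('a \<times> 'a) set" where
  "adj e = (\<Union>i<d. {e i, prod.swap (e i)})"

text \<open>Crossing an edge with another label leaves the partner of \<open>i\<close> unchanged,
  and crossing the edge of \<open>i\<close> makes it the end just left. Only vertices reachable from
  that edge are treated, because connectivity is itself derived from this.\<close>

lemma adj_values:
  assumes "\<tau> \<subseteq> L" "card \<tau> = Suc d"
    and e: "\<And>i. i < d \<Longrightarrow> edge \<tau> i (fst (e i)) (snd (e i))"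
    and i: "i < d" and r: "(fst (e i), x) \<in> (adj e)\<^sup>*"
  shows "W (\<tau> - {x}) i \<in> {fst (e i), snd (e i)}"
  using r
proof (induction rule: rtrancl_induct)
  case base
  then show ?case using edge_W[OF assms(1,2) e[OF i]] by simp
next
  case (step x y)
  obtain k where k: "k < d" "(x, y) = e k \<or> (y, x) = e k"
    using step.hyps(2) unfolding adj_def by (auto simp: prod_eq_iff)
  have E: "edge \<tau> k x y" using k e[OF k(1)] edge_sym by (metis fst_conv snd_conv)
  show ?case
  proof (cases "k = i")
    case True
    then show ?thesis
      using k(2) edge_W[OF assms(1,2) edge_sym[OF E]] by (metis fst_conv snd_conv insertCI)
  next
    case False
    then show ?thesis using E i step.IH unfolding edge_def by auto
  qed
qed

text \<open>Choose a root in every component. Sending each edge to its end far from the root of its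
  component injects the \<open>d\<close> edges into the non-roots of a set of size \<open>d + 1\<close>.\<close>

lemma adj_connected:
  assumes "\<tau> \<subseteq> L" "card \<tau> = Suc d"
    and e: "\<And>i. i < d \<Longrightarrow> edge \<tau> i (fst (e i)) (snd (e i))"
    and xy: "x \<in> \<tau>" "y \<in> \<tau>"
  shows "(x, y) \<in> (adj e)\<^sup>*"
proof -
  let ?G = "(adj e)\<^sup>*"
  have fin: "finite \<tau>" using assms(1) finL finite_subset by auto
  have "sym (adj e)" unfolding adj_def sym_def by (auto simp: prod_eq_iff)
  then have symG: "sym ?G" by (rule sym_rtrancl)
  have inT: "v \<in> \<tau>" if "(u, v) \<in> ?G" "u \<in> \<tau>" for u v
    using that
  proof (induction rule: rtrancl_induct)
    case (step v w)
    then obtain k where k: "k < d" "(v, w) = e k \<or> (w, v) = e k"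
      unfolding adj_def by (auto simp: prod_eq_iff)
    then show ?case using e[OF k(1)] unfolding edge_def by (metis fst_conv snd_conv)
  qed
  \<comment> \<open>The choice depends only on the set of vertices reachable from \<open>u\<close>,
    so it is constant on components.\<close>
  define root where "root u = (SOME v. (u, v) \<in> ?G)" for u
  have root: "(u, root u) \<in> ?G" for u
    unfolding root_def by (rule someI[of _ u]) simp
  have root_eq: "root u = root v" if "(u, v) \<in> ?G" for u v
  proof -
    have "(u, z) \<in> ?G \<longleftrightarrow> (v, z) \<in> ?G" for z
      using that symG by (meson rtrancl_trans symD)
    then show ?thesis unfolding root_def by simp
  qed
  define g where "g i = W (\<tau> - {root (fst (e i))}) i" for i
  have fstT: "fst (e i) \<in> \<tau>" if "i < d" for i using e[OF that] unfolding edge_def by auto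
  have rT: "root u \<in> \<tau>" if "u \<in> \<tau>" for u using inT[OF root that] .
  have gval: "g i \<in> {fst (e i), snd (e i)}" if "i < d" for i
    unfolding g_def using adj_values[OF assms(1,2) e that root] .
  have groot: "root (g i) = root (fst (e i))" if "i < d" for i
  proof -
    have "(fst (e i), snd (e i)) \<in> adj e" using that unfolding adj_def by auto
    then have "(fst (e i), snd (e i)) \<in> ?G" by blast
    then show ?thesis using gval[OF that] root_eq[of "fst (e i)" "snd (e i)"] by auto
  qed
  \<comment> \<open>Edges with the same far end lie in one component and share its root, and the
    matching that misses this root is injective.\<close>
  have "inj_on g {..<d}"
  proof (rule inj_onI)
    fix i j assume ij: "i \<in> {..<d}" "j \<in> {..<d}" "g i = g j"
    then have "root (fst (e i)) = root (fst (e j))" using groot[of i] groot[of j] by simp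
    then show "i = j"
      using ij W_inj[OF assms(1,2) rT[OF fstT]] unfolding g_def by auto
  qed
  moreover have "g ` {..<d} \<subseteq> \<tau> - root ` \<tau>"
  proof safe
    fix i assume i: "i < d"
    show "g i \<in> \<tau>" using W_in[OF assms(1,2) rT[OF fstT[OF i]] i] unfolding g_def by auto
  next
    fix i u assume i: "i < d" and u: "g i = root u" "u \<in> \<tau>"
    have "root (g i) = root u" using u root_eq[OF root] by metis
    then have "g i = root (fst (e i))" using groot[OF i] u by simp
    then show False using W_in[OF assms(1,2) rT[OF fstT[OF i]] i] unfolding g_def by auto
  qed
  ultimately have "d \<le> card (\<tau> - root ` \<tau>)"
    using card_inj_on_le[of g "{..<d}" "\<tau> - root ` \<tau>"] fin by simp
  also have "\<dots> = Suc d - card (root ` \<tau>)"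
    using card_Diff_subset[of "root ` \<tau>" \<tau>] rT fin assms(2) by auto
  finally have "card (root ` \<tau>) \<le> 1"
    using card_mono[OF fin, of "root ` \<tau>"] rT assms(2) by (auto simp: image_subset_iff)
  then have "root x = root y" using xy fin by (metis card_le_Suc0_iff_eq finite_imageI image_eqI One_nat_def)
  then show ?thesis using root[of x] root[of y] symG by (metis rtrancl_trans symD)
qed

text \<open>Any given edge with label \<open>i\<close> may serve as the chosen edge of that label,
  and the chosen edges connect \<tau>, so \<open>adj_values\<close> reaches every
  \<open>j\<close>.\<close>

lemma edge_values:
  assumes "\<tau> \<subseteq> L" "card \<tau> = Suc d" and E: "edge \<tau> i a b" and "j \<in> \<tau>"
  shows "W (\<tau> - {j}) i \<in> {a, b}"
proof -
  have "\<forall>k. \<exists>p. k < d \<longrightarrow> edge \<tau> k (fst p) (snd p)"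
    using edge_ex[OF assms(1,2)] by (metis fst_conv snd_conv)
  then obtain e0 where "\<And>k. k < d \<Longrightarrow> edge \<tau> k (fst (e0 k)) (snd (e0 k))" by metis
  then have e: "\<And>k. k < d \<Longrightarrow> edge \<tau> k (fst ((e0(i := (a, b))) k)) (snd ((e0(i := (a, b))) k))"
    using E by simp
  have "i < d" "a \<in> \<tau>" using E unfolding edge_def by auto
  with adj_values[OF assms(1,2) e, of i j] adj_connected[OF assms(1,2) e, of a j] assms(4)
  show ?thesis by simp
qed

lemma edge_induct:
  assumes "\<tau> \<subseteq> L" "card \<tau> = Suc d" "x \<in> \<tau>" "y \<in> \<tau>" and "P x"
    and step: "\<And>u v k. \<lbrakk>P u; edge \<tau> k u v\<rbrakk> \<Longrightarrow> P v"
  shows "P y"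
proof -
  have "\<forall>k. \<exists>p. k < d \<longrightarrow> edge \<tau> k (fst p) (snd p)"
    using edge_ex[OF assms(1,2)] by (metis fst_conv snd_conv)
  then obtain e where e: "\<And>k. k < d \<Longrightarrow> edge \<tau> k (fst (e k)) (snd (e k))" by metis
  have "(x, y) \<in> (adj e)\<^sup>*" using adj_connected[OF assms(1,2) e assms(3,4)] .
  then show ?thesis
  proof (induction rule: rtrancl_induct)
    case base show ?case by fact
  next
    case (step u v)
    then obtain k where k: "k < d" "(u, v) = e k \<or> (v, u) = e k"
      unfolding adj_def by (auto simp: prod_eq_iff)
    have "edge \<tau> k u v" using k e[OF k(1)] edge_sym by (metis fst_conv snd_conv)
    then show ?case using assms(6) step.IH by blast
  qed
qed

text \<open>\<open>c\<close> is the first vertex of \<open>S\<close> on a walk from \<open>b\<close> in the tree, and rerooting from \<open>b\<close> to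
  \<open>c\<close> only changes the edges on that walk.\<close>

lemma first_entry:
  assumes "\<tau> \<subseteq> L" "card \<tau> = Suc d" and S: "S \<subseteq> \<tau>" "S \<noteq> {}" and b: "b \<in> \<tau>" "b \<notin> S"
  obtains x c k where "x \<in> \<tau>" "x \<notin> S" "c \<in> S" "edge \<tau> k x c" "W (\<tau> - {b}) k = c"
    "\<And>j. \<lbrakk>j < d; j \<noteq> k; W (\<tau> - {b}) j \<in> S\<rbrakk> \<Longrightarrow> W (\<tau> - {c}) j = W (\<tau> - {b}) j"
proof -
  \<comment> \<open>\<open>P\<close> describes a walk that has not yet met \<open>S\<close>: every
    right vertex whose partner at the root \<open>b\<close> lies in \<open>S\<close> still has this
    partner.\<close>
  define P where "P x \<longleftrightarrow> x \<in> \<tau> \<and> x \<notin> S \<and>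
    (\<forall>j<d. W (\<tau> - {b}) j \<in> S \<longrightarrow> W (\<tau> - {x}) j = W (\<tau> - {b}) j)" for x
  obtain s where s: "s \<in> S" using S by auto
  have "P b" using b by (simp add: P_def)
  have "\<exists>x c k. P x \<and> c \<in> S \<and> edge \<tau> k x c"
  proof (rule ccontr)
    assume no: "\<not> ?thesis"
    have "P s"
    proof (rule edge_induct[where P = P, OF assms(1,2) b(1) _ \<open>P b\<close>])
      show "s \<in> \<tau>" using s S by auto
    next
      fix u v k assume u: "P u" and E: "edge \<tau> k u v"
      then have v: "v \<in> \<tau>" "v \<notin> S" using no unfolding edge_def by blast+
      have "W (\<tau> - {v}) j = W (\<tau> - {b}) j" if j: "j < d" "W (\<tau> - {b}) j \<in> S" for j
      proof -
        have uj: "W (\<tau> - {u}) j = W (\<tau> - {b}) j" using u j by (auto simp: P_def)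
        then have "j \<noteq> k" using edge_W[OF assms(1,2) E] v j by auto
        then show ?thesis using uj E j by (auto simp: edge_def)
      qed
      then show "P v" using v by (simp add: P_def)
    qed
    then show False using s by (simp add: P_def)
  qed
  then obtain x c k where x: "P x" "c \<in> S" "edge \<tau> k x c" by blast
  have ct: "c \<in> \<tau>" "c \<noteq> b" using x S b by auto
  \<comment> \<open>The right vertex with partner \<open>c\<close> at the root \<open>b\<close>
    still has it at \<open>x\<close>, so it must be the label of the edge that enters
    \<open>S\<close>.\<close>
  obtain k0 where k0: "k0 < d" "W (\<tau> - {b}) k0 = c" using W_surj[OF assms(1,2) b(1) ct] .
  have "W (\<tau> - {x}) k0 = c" using x k0 by (auto simp: P_def)
  moreover have "W (\<tau> - {x}) k = c" using edge_W[OF assms(1,2) x(3)] .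
  ultimately have "k0 = k"
    using W_inj[OF assms(1,2), of x k0 k] x k0 by (auto simp: P_def edge_def)
  show thesis
  proof (rule that[of x c k])
    fix j assume "j < d" "j \<noteq> k" "W (\<tau> - {b}) j \<in> S"
    then show "W (\<tau> - {c}) j = W (\<tau> - {b}) j" using x by (auto simp: P_def edge_def)
  qed (use x k0 \<open>k0 = k\<close> in \<open>auto simp: P_def\<close>)
qed

subsection \<open>Compatibility of the matchings\<close>

theorem matchings_compatible:
  assumes "\<sigma> \<subseteq> L" "card \<sigma> = d" "\<sigma>' \<subseteq> L" "card \<sigma>' = d"
    and "I \<subseteq> {..<d}" and "W \<sigma> ` I = W \<sigma>' ` I" and "k \<in> I"
  shows "W \<sigma> k = W \<sigma>' k"
  using assms
proof (induction "card (\<sigma> \<union> \<sigma>')" arbitrary: \<sigma> \<sigma>' k rule: less_induct)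
  case less
  note sub = less.prems
  define L0 where "L0 = \<sigma> \<union> \<sigma>'"
  have L0: "L0 \<subseteq> L" "finite L0" using sub finL finite_subset unfolding L0_def by auto
  define G where "G = {\<rho>. \<rho> \<subseteq> L0 \<and> card \<rho> = d \<and> (\<forall>k\<in>I. W \<rho> k = W \<sigma>' k)}"
  have fin: "finite \<sigma>" "finite \<sigma>'" using L0 by (auto simp: L0_def)
  show ?case
  proof (rule ccontr)
    assume neq: "W \<sigma> k \<noteq> W \<sigma>' k"
    \<comment> \<open>A member of \<open>G\<close> disagrees with \<sigma> on \<open>I\<close> just
      as \<sigma>' does, so by minimality of the union it must cover \<open>L0\<close> together with
      \<sigma>.\<close>
    have cover: "\<rho> \<union> \<sigma> = L0" if "\<rho> \<in> G" for \<rho>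
    proof (rule ccontr)
      assume "\<rho> \<union> \<sigma> \<noteq> L0"
      then have "\<sigma> \<union> \<rho> \<subset> L0" using that unfolding G_def L0_def by auto
      then have "card (\<sigma> \<union> \<rho>) < card (\<sigma> \<union> \<sigma>')" using psubset_card_mono[of L0 "\<sigma> \<union> \<rho>"] L0(2) unfolding L0_def by simp
      moreover have "W \<sigma> ` I = W \<rho> ` I" using that sub(6) unfolding G_def by auto
      ultimately have "W \<sigma> k = W \<rho> k"
        using less.hyps[of \<sigma> \<rho>] sub that L0 unfolding G_def by auto
      then show False using that neq sub(7) unfolding G_def by auto
    qed
    \<comment> \<open>The candidates for the next drop: vertices outside \<open>C\<close> that some
      member of \<open>G\<close> misses along with all of \<open>C\<close>.\<close>
    define X where "X C = (\<Union>\<rho>\<in>{\<rho>\<in>G. \<rho> \<inter> C = {}}. L0 - \<rho>) - C" for C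
    define s where "s = card (\<sigma>' - \<sigma>)"
    have cardL0: "card L0 = d + s"
      unfolding L0_def s_def using card_Un_disjoint[of \<sigma> "\<sigma>' - \<sigma>"] fin sub(2) by simp
    have s_pos: "s > 0"
    proof (rule ccontr)
      assume "\<not> 0 < s"
      then have "\<sigma>' \<subseteq> \<sigma>" using fin unfolding s_def by simp
      then have "\<sigma>' = \<sigma>" using card_subset_eq fin sub by metis
      then show False using neq by simp
    qed
    have X_sub: "X C \<subseteq> \<sigma> - C" for C
    proof
      fix z assume "z \<in> X C"
      then obtain \<rho> where "\<rho> \<in> G" "z \<in> L0 - \<rho>" "z \<notin> C" unfolding X_def by auto
      then show "z \<in> \<sigma> - C" using cover[of \<rho>] by auto
    qed
    text \<open>\<open>\<sigma> \<union> B - C\<close> interpolates between \<open>\<sigma>\<close> and a member of \<open>G\<close>.\<close>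
    define inv where "inv B C \<longleftrightarrow> B \<subseteq> \<sigma>' - \<sigma> \<and> C \<subseteq> \<sigma> \<and> card B = card C \<and>
      (\<exists>\<rho>\<in>G. \<rho> \<inter> C = {}) \<and> (\<forall>i\<in>I. W ((\<sigma> \<union> B) - C) i \<notin> X C)" for B C
    have step: "\<exists>b c x i. b \<in> \<sigma>' - \<sigma> - B \<and> c \<in> X C \<and> x \<in> \<sigma> \<union> insert b B - C \<and> x \<notin> X C \<and>
        i \<notin> I \<and> edge (\<sigma> \<union> insert b B - C) i x c \<and> inv (insert b B) (insert c C)"
      if I: "inv B C" and c: "card C < s" for B C
    proof -
      have finBC: "finite B" "finite C"
        using I fin finite_subset unfolding inv_def by auto
      have "B \<noteq> \<sigma>' - \<sigma>" using I c unfolding inv_def s_def by auto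
      then obtain b where b: "b \<in> \<sigma>' - \<sigma> - B" using I unfolding inv_def by auto
      define \<tau> where "\<tau> = \<sigma> \<union> insert b B - C"
      have \<tau>L: "\<tau> \<subseteq> L" using I b sub unfolding \<tau>_def inv_def by auto
      have "card (\<sigma> \<union> insert b B) = d + Suc (card B)"
        using card_Un_disjoint[of \<sigma> "insert b B"] I b fin finBC sub(2) unfolding inv_def by auto
      moreover have "C \<subseteq> \<sigma> \<union> insert b B" using I unfolding inv_def by auto
      ultimately have c\<tau>: "card \<tau> = Suc d"
        unfolding \<tau>_def using card_Diff_subset[OF finBC(2)] I unfolding inv_def by auto
      have b\<tau>: "b \<in> \<tau>" "b \<notin> X C" using b I X_sub[of C] unfolding \<tau>_def inv_def by auto
      have \<tau>b: "\<tau> - {b} = \<sigma> \<union> B - C" using b unfolding \<tau>_def by auto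
      obtain \<rho> where \<rho>: "\<rho> \<in> G" "\<rho> \<inter> C = {}" using I unfolding inv_def by auto
      \<comment> \<open>A member of \<open>G\<close> misses \<open>s\<close> vertices, more than
        \<open>C\<close> has, so a candidate remains.\<close>
      have "card (L0 - \<rho>) = s"
        using \<rho>(1) card_Diff_subset[of \<rho> L0] L0 cardL0 finite_subset[of \<rho> L0] unfolding G_def by auto
      then have "\<not> L0 - \<rho> \<subseteq> C" using card_mono[OF finBC(2), of "L0 - \<rho>"] c by auto
      then have Xne: "X C \<noteq> {}" using \<rho> unfolding X_def by auto
      have X\<tau>: "X C \<subseteq> \<tau>" using X_sub[of C] unfolding \<tau>_def by auto
      obtain x c i where xc: "x \<in> \<tau>" "x \<notin> X C" "c \<in> X C" "edge \<tau> i x c" "W (\<tau> - {b}) i = c"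
        and keep: "\<And>j. \<lbrakk>j < d; j \<noteq> i; W (\<tau> - {b}) j \<in> X C\<rbrakk> \<Longrightarrow> W (\<tau> - {c}) j = W (\<tau> - {b}) j"
        using first_entry[OF \<tau>L c\<tau> X\<tau> Xne b\<tau>] by metis
      \<comment> \<open>No right vertex in \<open>I\<close> has its partner in \<open>X C\<close>,
        so the edge that enters \<open>X C\<close> has its label outside \<open>I\<close>.\<close>
      have iI: "i \<notin> I" using I xc \<tau>b unfolding inv_def by auto
      have cC: "c \<notin> C" "c \<in> \<sigma>" using X_sub[of C] xc by auto
      have \<tau>c: "\<tau> - {c} = \<sigma> \<union> insert b B - insert c C" unfolding \<tau>_def by auto
      have Xsub: "X (insert c C) \<subseteq> X C - {c}" unfolding X_def by auto
      \<comment> \<open>Rerooting from \<open>b\<close> to \<open>c\<close> preserves the right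
        vertex matched to each candidate other than \<open>c\<close>, so a violation after the
        exchange would have been one before it.\<close>
      have "W (\<tau> - {c}) j \<notin> X (insert c C)" if j: "j \<in> I" for j
      proof
        assume z: "W (\<tau> - {c}) j \<in> X (insert c C)"
        let ?z = "W (\<tau> - {c}) j"
        have zX: "?z \<in> X C" "?z \<noteq> c" using z Xsub by auto
        have "?z \<in> \<tau>" "?z \<noteq> b" using zX X\<tau> b\<tau> by auto
        then obtain j' where j': "j' < d" "W (\<tau> - {b}) j' = ?z"
          using W_surj[OF \<tau>L c\<tau> b\<tau>(1)] by metis
        have "j' \<noteq> i" using j' zX xc by auto
        then have "W (\<tau> - {c}) j' = ?z" using keep[of j'] j' zX by auto
        then have "j' = j"
          using W_inj[OF \<tau>L c\<tau>, of c j' j] j j' sub(5) X\<tau> xc by auto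
        then show False using I j j' zX \<tau>b unfolding inv_def by auto
      qed
      moreover have "\<exists>\<rho>\<in>G. \<rho> \<inter> insert c C = {}" using xc(3) unfolding X_def by auto
      moreover have "card (insert b B) = card (insert c C)"
        using b cC finBC I unfolding inv_def by auto
      ultimately have "inv (insert b B) (insert c C)"
        using I b cC \<tau>c unfolding inv_def by auto
      then show ?thesis using b xc iI unfolding \<tau>_def by blast
    qed
    have inv0: "inv {} {}"
    proof -
      have "W \<sigma> i \<notin> X {}" if "i \<in> I" for i
      proof
        assume "W \<sigma> i \<in> X {}"
        then obtain \<rho> where \<rho>: "\<rho> \<in> G" "W \<sigma> i \<notin> \<rho>" unfolding X_def by auto
        have "bij_betw (W \<rho>) {..<d} \<rho>" using bij \<rho> L0 unfolding G_def by auto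
        then have "W \<rho> ` I \<subseteq> \<rho>" using sub(5) unfolding bij_betw_def by auto
        moreover have "W \<sigma> i \<in> W \<rho> ` I" using that \<rho> sub(6) unfolding G_def by force
        ultimately show False using \<rho> by auto
      qed
      moreover have "\<sigma>' \<in> G" using sub unfolding G_def L0_def by auto
      ultimately show ?thesis unfolding inv_def by auto
    qed
    \<comment> \<open>The iteration stops one exchange before \<sigma>' - \<sigma> is used up; the
      last exchange is inspected on its own.\<close>
    have "\<exists>B C. inv B C \<and> card C = j" if "j < s" for j
      using that
    proof (induction j)
      case 0
      then show ?case using inv0 by (intro exI[of _ "{}"]) auto
    next
      case (Suc j)
      then obtain B C where BC: "inv B C" "card C = j" by auto
      obtain b c where bc: "c \<in> X C" "inv (insert b B) (insert c C)"
        using step[OF BC(1)] BC(2) Suc.prems by auto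
      have "c \<notin> C" "finite C"
        using bc(1) X_sub[of C] BC(1) fin(1) finite_subset[of C \<sigma>] unfolding inv_def by auto
      then have "card (insert c C) = Suc j" using BC by simp
      then show ?case using bc by blast
    qed
    then obtain B C where BC: "inv B C" "card C = s - 1" using s_pos by (metis diff_less zero_less_one)
    then obtain b c x i where st: "b \<in> \<sigma>' - \<sigma> - B" "c \<in> X C" "x \<in> \<sigma> \<union> insert b B - C" "x \<notin> X C"
      "i \<notin> I" "edge (\<sigma> \<union> insert b B - C) i x c" "inv (insert b B) (insert c C)"
      using step[of B C] s_pos by auto
    have finB: "finite B" using BC(1) fin(2) finite_subset unfolding inv_def by blast
    have "card (insert b B) = s"
      using BC st(1) s_pos finB unfolding inv_def by auto
    then have "insert b B = \<sigma>' - \<sigma>"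
      using card_subset_eq[of "\<sigma>' - \<sigma>" "insert b B"] fin st(7) unfolding s_def inv_def by auto
    then have \<tau>: "\<sigma> \<union> insert b B - C = L0 - C" unfolding L0_def by auto
    obtain \<rho> where \<rho>: "\<rho> \<in> G" "\<rho> \<inter> insert c C = {}" using st(7) unfolding inv_def by auto
    have cC: "c \<notin> C" "c \<in> \<sigma>" "C \<subseteq> \<sigma>" using st(2) X_sub[of C] BC(1) unfolding inv_def by auto
    \<comment> \<open>Once \<open>s\<close> vertices are dropped, counting forces the member of
      \<open>G\<close> that avoids them to be their complement in \<open>L0\<close>.\<close>
    have "card (L0 - insert c C) = d"
    proof -
      have "finite C" using cC fin finite_subset by blast
      then have "card (insert c C) = s" using BC cC s_pos by simp
      then show ?thesis
        using card_Diff_subset[of "insert c C" L0] \<open>finite C\<close> cC cardL0 unfolding L0_def by auto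
    qed
    moreover have "\<rho> \<subseteq> L0 - insert c C" using \<rho> unfolding G_def by auto
    ultimately have "\<rho> = L0 - insert c C"
      using card_subset_eq[of "L0 - insert c C" \<rho>] \<rho> L0 unfolding G_def by auto
    then have \<rho>_eq: "\<rho> = L0 - C - {c}" by auto
    have E: "edge (L0 - C) i x c" using st(6) \<tau> by simp
    have xL: "x \<in> L0 - C" using E unfolding edge_def by auto
    \<comment> \<open>The label \<open>i\<close> lies outside \<open>I\<close>, so leaving out
      \<open>x\<close> in place of \<open>c\<close> keeps all partners of \<open>I\<close>. This
      puts \<open>x\<close> into \<open>X C\<close>, although the edge entered \<open>X C\<close>
      from outside.\<close>
    have "W (L0 - C - {x}) j = W \<sigma>' j" if "j \<in> I" for j
    proof -
      have "j < d" "j \<noteq> i" using that sub(5) st(5) by auto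
      then have "W (L0 - C - {x}) j = W \<rho> j" using E unfolding edge_def \<rho>_eq by auto
      then show ?thesis using \<rho>(1) that unfolding G_def by auto
    qed
    moreover have "card (L0 - C - {x}) = d"
    proof -
      have "c \<in> L0 - C" "finite (L0 - C)" using E L0 unfolding edge_def by auto
      then have "card (L0 - C) = Suc (card \<rho>)" unfolding \<rho>_eq by (metis card.remove)
      then have "card (L0 - C) = Suc d" using \<rho>(1) unfolding G_def by auto
      then show ?thesis using xL L0 by simp
    qed
    ultimately have "L0 - C - {x} \<in> G" unfolding G_def by auto
    then have "x \<in> X C" using xL unfolding X_def by auto
    then show False using st(4) by simp
  qed
qed

end

subsection \<open>Splitting a right vertex\<close>

context linkage_field
begin

text \<open>Collecting the partners of \<open>i\<close> over all omitted vertices yields the ends of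
  its tree edge without choosing an edge.\<close>

definition ends :: "'a set \<Rightarrow> nat \<Rightarrow> 'a set" where
  "ends \<tau> i = (\<lambda>j. W (\<tau> - {j}) i) ` \<tau>"

lemma ends_edge:
  assumes "\<tau> \<subseteq> L" "card \<tau> = Suc d" "edge \<tau> i a b"
  shows "ends \<tau> i = {a, b}"
proof
  show "ends \<tau> i \<subseteq> {a, b}" using edge_values[OF assms] unfolding ends_def by auto
  have "a \<in> \<tau>" "b \<in> \<tau>" using assms(3) unfolding edge_def by auto
  then have "W (\<tau> - {a}) i \<in> ends \<tau> i" "W (\<tau> - {b}) i \<in> ends \<tau> i"
    unfolding ends_def by (auto intro: rev_image_eqI)
  then show "{a, b} \<subseteq> ends \<tau> i"
    unfolding edge_W[OF assms] edge_W[OF assms(1,2) edge_sym[OF assms(3)]] by blast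
qed

lemma edge_if_ends:
  assumes "\<tau> \<subseteq> L" "card \<tau> = Suc d" "i < d" "u \<in> ends \<tau> i" "v \<in> ends \<tau> i" "u \<noteq> v"
  shows "edge \<tau> i u v"
proof -
  obtain a b where ab: "edge \<tau> i a b" using edge_ex[OF assms(1-3)] .
  have "ends \<tau> i = {a, b}" by (rule ends_edge[OF assms(1,2) ab])
  then have "u = a \<and> v = b \<or> u = b \<and> v = a" using assms(4-6) by auto
  then show ?thesis using ab edge_sym[OF ab] by blast
qed

end

text \<open>For a set \<open>T\<close> of size \<open>d + 2\<close>, \<open>om k x y\<close> is the left vertex matched to \<open>k\<close> when \<open>x\<close> and
  \<open>y\<close> are left out, and \<open>E k x\<close> is the edge of \<open>k\<close> in the linkage tree of \<open>T - {x}\<close>.\<close>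

locale linkage_field_pair = linkage_field L d W
  for L :: "'a::linorder set" and d W +
  fixes T :: "'a set"
  assumes TL: "T \<subseteq> L" and cT: "card T = d + 2"
begin

definition om :: "nat \<Rightarrow> 'a \<Rightarrow> 'a \<Rightarrow> 'a" where
  "om k x y = W (T - {x, y}) k"

definition E :: "nat \<Rightarrow> 'a \<Rightarrow> 'a set" where
  "E k x = ends (T - {x}) k"

lemma om_sym: "om k x y = om k y x"
  unfolding om_def by (subst insert_commute) (rule refl)

lemma om_eq: "W (T - {x} - {y}) k = om k x y"
  by (metis om_def Diff_insert2)

lemma Tx:
  assumes "x \<in> T"
  shows "T - {x} \<subseteq> L" "card (T - {x}) = Suc d"
  using assms TL cT by auto

lemma E_om: "\<lbrakk>x \<in> T; y \<in> T; x \<noteq> y\<rbrakk> \<Longrightarrow> om k x y \<in> E k x"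
  unfolding E_def ends_def om_eq[symmetric] by auto

lemma E_om': "\<lbrakk>x \<in> T; y \<in> T; x \<noteq> y\<rbrakk> \<Longrightarrow> om k x y \<in> E k y"
  using E_om[of y x k] by (simp add: om_sym)

lemma om_in: "\<lbrakk>x \<in> T; y \<in> T; x \<noteq> y; k < d\<rbrakk> \<Longrightarrow> om k x y \<in> T - {x, y}"
  using W_in[OF Tx, of x y k] by (auto simp: om_eq)

lemma E_sub: "\<lbrakk>x \<in> T; k < d\<rbrakk> \<Longrightarrow> E k x \<subseteq> T - {x}"
  using W_in[OF Tx, of x _ k] unfolding E_def ends_def by auto

lemma E_edge:
  assumes "x \<in> T" "k < d" "u \<in> E k x" "v \<in> E k x" "u \<noteq> v"
  shows "E k x = {u, v}" "om k x u = v" "om k x v = u"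
    "\<And>j. \<lbrakk>j < d; j \<noteq> k\<rbrakk> \<Longrightarrow> om j x u = om j x v"
proof -
  have e: "edge (T - {x}) k u v"
    using edge_if_ends[OF Tx assms(2)] assms unfolding E_def by auto
  show "E k x = {u, v}" using ends_edge[OF Tx e] assms unfolding E_def by auto
  show "om k x u = v" using edge_W[OF Tx e] assms by (simp add: om_eq)
  show "om k x v = u" using edge_W[OF Tx edge_sym[OF e]] assms by (simp add: om_eq)
  show "om j x u = om j x v" if "j < d" "j \<noteq> k" for j
    using e that unfolding edge_def by (simp add: om_eq)
qed

lemma E_ex:
  assumes "x \<in> T" "k < d"
  obtains u v where "u \<noteq> v" "E k x = {u, v}"
proof -
  obtain a b where "edge (T - {x}) k a b" using edge_ex[OF Tx assms(2)] assms by metis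
  then show thesis using that ends_edge[OF Tx] assms unfolding E_def edge_def by metis
qed

text \<open>Leaving out any two vertices of the triple matches \<open>i\<close> to the third.
  Starting from the \<open>i\<close>-edge {y, z} of some \<open>x\<close>, the symmetry of
  \<open>om\<close> shows that \<open>om i y z\<close>, possibly different from \<open>x\<close>,
  completes \<open>y\<close> and \<open>z\<close> to such a triple. It is sorted because
  \<open>split\<close> uses \<open>Min\<close> and \<open>Max\<close>.\<close>

lemma triple_ex:
  assumes i: "i < d"
  obtains p q s where "p \<in> T" "q \<in> T" "s \<in> T" "p < q" "q < s"
    "E i p = {q, s}" "E i q = {p, s}" "E i s = {p, q}"
proof -
  obtain x where x: "x \<in> T" using cT by (metis card.empty ex_in_conv add_is_0 zero_neq_numeral)
  obtain y z where yz: "y \<noteq> z" "E i x = {y, z}" using E_ex[OF x i] .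
  have T: "y \<in> T" "z \<in> T" "y \<noteq> x" "z \<noteq> x" using E_sub[OF x i] yz by auto
  have om1: "om i y x = z" "om i z x = y" using E_edge[OF x i, of y z] yz by (auto simp: om_sym)
  define x' where "x' = om i y z"
  have x': "x' \<in> T" "x' \<noteq> y" "x' \<noteq> z" using om_in[OF T(1,2) yz(1) i] unfolding x'_def by auto
  have "z \<in> E i y" "x' \<in> E i y" using E_om[of y x i] E_om[of y z i] T x yz om1 unfolding x'_def by auto
  then have Ey: "E i y = {z, x'}" "om i y x' = z" using E_edge[OF T(1) i] x' by metis+
  have "y \<in> E i z" "x' \<in> E i z" using E_om[of z x i] E_om'[of y z i] T x yz om1 unfolding x'_def by auto
  then have Ez: "E i z = {y, x'}" "om i z x' = y" using E_edge[OF T(2) i] x' by metis+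
  have "z \<in> E i x'" "y \<in> E i x'"
    using E_om'[of y x' i] E_om'[of z x' i] T x' Ey Ez by auto
  then have Ex: "E i x' = {y, z}" using E_edge[OF x'(1) i] yz by metis
  consider "x' < y \<and> y < z" | "x' < z \<and> z < y" | "y < x' \<and> x' < z" | "z < x' \<and> x' < y"
    | "y < z \<and> z < x'" | "z < y \<and> y < x'"
    using yz x' by (metis neqE)
  then show thesis
    using that x' T Ex Ey Ez by cases (auto simp: insert_commute)
qed

text \<open>For \<open>k \<noteq> i\<close> the linkage pair of the split field is read off from an \<open>a\<close> that lies on
  the \<open>i\<close>-edges of both \<open>x\<close> and \<open>y\<close>.\<close>

lemma common_end_ex:
  assumes i: "i < d" and k: "k < d" "k \<noteq> i"
  obtains x y a where "x \<in> T" "y \<in> T" "a \<in> T" "x \<noteq> y" "a \<in> E i x" "a \<in> E i y" "E k a = {x, y}"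
proof -
  obtain p q s where pqs: "p \<in> T" "q \<in> T" "s \<in> T" "p < q" "q < s"
    and Ei: "E i p = {q, s}" "E i q = {p, s}" "E i s = {p, q}"
    using triple_ex[OF i] .
  have ne: "p \<noteq> q" "q \<noteq> s" "p \<noteq> s" using pqs by auto
  \<comment> \<open>Each pair from the triple is the \<open>i\<close>-edge of the third vertex, so
    the matchings that leave out a pair agree away from \<open>i\<close>; \<open>y\<close> is their
    common partner of \<open>k\<close>.\<close>
  define y where "y = om k p q"
  have "om k q p = om k q s" using E_edge(4)[OF pqs(2) i, of p s k] Ei ne k by simp
  then have y2: "om k q s = y" by (simp add: y_def om_sym)
  have "om k p q = om k p s" using E_edge(4)[OF pqs(1) i, of q s k] Ei ne k by simp
  then have y3: "om k p s = y" by (simp add: y_def)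
  have yT: "y \<in> T" "y \<noteq> p" "y \<noteq> q" "y \<noteq> s"
    using om_in[of p q k] om_in[of q s k] pqs ne k y2 unfolding y_def by auto
  text \<open>The third vertex of the triple plays no special role, so \<open>q\<close>, \<open>s\<close> stand for any two
    of \<open>p\<close>, \<open>q\<close>, \<open>s\<close>.\<close>
  have main: "\<exists>x a. x \<in> T \<and> a \<in> T \<and> x \<noteq> y \<and> a \<in> E i x \<and> a \<in> E i y \<and> E k a = {x, y}"
    if T: "p \<in> T" "q \<in> T" "s \<in> T" and ne: "p \<noteq> q" "q \<noteq> s" "p \<noteq> s"
      and Ei: "E i p = {q, s}" "E i q = {p, s}" "E i s = {p, q}"
      and omk: "om k p q = y" "om k q s = y" "om k p s = y"
      and yne: "y \<noteq> p" "y \<noteq> q" "y \<noteq> s"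
      and xeq: "om k q y = om k s y" for p q s
  proof -
    define x where "x = om k q y"
    have xT: "x \<in> T" "x \<noteq> q" "x \<noteq> y" "x \<noteq> s"
      using om_in[of q y k] om_in[of s y k] T yT(1) yne k xeq unfolding x_def by auto
    have "x \<in> E k q" "y \<in> E k q" "x \<in> E k s" "y \<in> E k s"
      using E_om[of q y k] E_om[of q s k] E_om[of s y k] E_om'[of q s k] T yT(1) yne ne omk xeq
      unfolding x_def by auto
    note Eq = E_edge[OF T(2) k(1) this(1,2) xT(3)] and Es = E_edge[OF T(3) k(1) this(3,4) xT(3)]
    have wq: "om i q x = om i q y" using Eq(4)[OF i] k by auto
    have ws: "om i s x = om i s y" using Es(4)[OF i] k by auto
    have inq: "om i q y \<in> {p, s}" using E_om[of q y i] T yT(1) yne Ei by auto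
    have ins: "om i s y \<in> {p, q}" using E_om[of s y i] T yT(1) yne Ei by auto
    have up: "om i q y \<in> E i y" "om i q y \<in> E i x" "om i s y \<in> E i y" "om i s y \<in> E i x"
      using E_om'[of q y i] E_om'[of q x i] E_om'[of s y i] E_om'[of s x i] T yT(1) yne xT wq ws
      by auto
    \<comment> \<open>The edges of \<open>k\<close> at \<open>q\<close> and at \<open>s\<close> are
      both {x, y}, so \<open>q\<close> or \<open>s\<close> can serve as \<open>a\<close> if it is
      one of these \<open>i\<close>-partners. Otherwise both partners are \<open>p\<close>, and the
      edge of \<open>k\<close> at \<open>p\<close> has to be found.\<close>
    show ?thesis
    proof (cases "om i q y = s \<or> om i s y = q")
      case True
      then show ?thesis using up Eq(1) Es(1) xT T by metis
    next
      case False
      then have p: "om i q y = p" "om i s y = p" using inq ins by auto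
      have pin: "p \<in> E i y" "p \<in> E i x" using up p by auto
      have "om i p y \<in> {q, s}" using E_om[of p y i] T yT(1) yne Ei by auto
      moreover have "om k p y = x" if c: "om i p y = c" "c = q \<or> c = s" for c
      proof -
        have "c \<in> E i y" using E_om'[of p y i] c T yT(1) yne by auto
        moreover have "p \<noteq> c" using c ne by auto
        ultimately have "om k y p = om k y c" using E_edge(4)[OF yT(1) i pin(1)] k by auto
        then show ?thesis using c xeq by (auto simp: x_def om_sym)
      qed
      ultimately have "om k p y = x" by auto
      then have "x \<in> E k p" "y \<in> E k p"
        using E_om[of p y k] E_om[of p q k] T yT(1) yne ne omk by auto
      then have "E k p = {x, y}" using E_edge(1)[OF T(1) k(1)] xT by auto
      then show ?thesis using pin xT T by metis
    qed
  qed
  obtain u v where uv: "E k y = {u, v}" using E_ex[OF yT(1) k(1)] .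
  \<comment> \<open>Pigeonhole: the edge of \<open>k\<close> at \<open>y\<close> has two ends, so
    two of the three partners coincide.\<close>
  have "om k p y \<in> {u, v}" "om k q y \<in> {u, v}" "om k s y \<in> {u, v}"
    using E_om'[of p y k] E_om'[of q y k] E_om'[of s y k] pqs yT uv by auto
  then consider "om k q y = om k s y" | "om k p y = om k s y" | "om k p y = om k q y" by auto
  then have "\<exists>x a. x \<in> T \<and> a \<in> T \<and> x \<noteq> y \<and> a \<in> E i x \<and> a \<in> E i y \<and> E k a = {x, y}"
  proof cases
    case 1
    show ?thesis by (rule main[of p q s]) (use pqs ne Ei y2 y3 y_def yT 1 in auto)
  next
    case 2
    show ?thesis by (rule main[of q p s]) (use pqs ne Ei y2 y3 y_def yT 2 in \<open>auto simp: om_sym\<close>)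
  next
    case 3
    show ?thesis by (rule main[of s p q]) (use pqs ne Ei y2 y3 y_def yT 3 in \<open>auto simp: om_sym\<close>)
  qed
  then show thesis using that yT by blast
qed

end

context linkage_field
begin

text \<open>The new right vertex \<open>d\<close> is a copy of \<open>i\<close>. The two ends are attached in increasing order
  because the linkage axiom for the copies needs a consistent choice.\<close>

definition split :: "nat \<Rightarrow> 'a set \<Rightarrow> nat \<Rightarrow> 'a" where
  "split i \<tau> k = (if k = i then Min (ends \<tau> i) else if k = d then Max (ends \<tau> i)
     else W (\<tau> - {Min (ends \<tau> i)}) k)"

lemma split_edge:
  assumes \<tau>: "\<tau> \<subseteq> L" "card \<tau> = Suc d" and i: "i < d"
  shows "edge \<tau> i (split i \<tau> i) (split i \<tau> d)"
    and "\<And>k. \<lbrakk>k < d; k \<noteq> i\<rbrakk> \<Longrightarrow> split i \<tau> k = W (\<tau> - {split i \<tau> i}) k"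
    and "\<And>k. \<lbrakk>k < d; k \<noteq> i\<rbrakk> \<Longrightarrow> split i \<tau> k = W (\<tau> - {split i \<tau> d}) k"
proof -
  obtain a b where ab: "edge \<tau> i a b" using edge_ex[OF \<tau> i] .
  then have en: "ends \<tau> i = {a, b}" "a \<noteq> b" using ends_edge[OF \<tau>] unfolding edge_def by auto
  show e: "edge \<tau> i (split i \<tau> i) (split i \<tau> d)"
    using ab edge_sym[OF ab] en i by (auto simp: split_def min_def max_def)
  show s: "split i \<tau> k = W (\<tau> - {split i \<tau> i}) k" if "k < d" "k \<noteq> i" for k
    using that by (simp add: split_def)
  show "split i \<tau> k = W (\<tau> - {split i \<tau> d}) k" if "k < d" "k \<noteq> i" for k
    using s[OF that] e that unfolding edge_def by auto
qed

text \<open>Leaving out the vertex given to the new copy returns to a matching of the old field,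
  with \<open>i\<close> keeping its own end.\<close>

lemma split_minus_copy:
  assumes \<tau>: "\<tau> \<subseteq> L" "card \<tau> = Suc d" and i: "i < d" and k: "k < d"
  shows "split i \<tau> k = W (\<tau> - {split i \<tau> d}) k"
  using split_edge(3)[OF \<tau> i k] edge_W[OF \<tau> edge_sym[OF split_edge(1)[OF \<tau> i]]]
  by (cases "k = i") auto

lemma linkage_field_split:
  assumes i: "i < d"
  shows "linkage_field L (Suc d) (split i)"
proof
  show "finite L" by (fact finL)
next
  fix \<tau> assume \<tau>: "\<tau> \<subseteq> L" "card \<tau> = Suc d"
  note se = split_edge[OF \<tau> i]
  let ?a = "split i \<tau> i" and ?b = "split i \<tau> d"
  have ab: "?a \<in> \<tau>" "?b \<in> \<tau>" "?a \<noteq> ?b" using se(1) unfolding edge_def by auto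
  have "\<tau> \<subseteq> split i \<tau> ` {..<Suc d}"
  proof
    fix z assume z: "z \<in> \<tau>"
    show "z \<in> split i \<tau> ` {..<Suc d}"
    proof (cases "z = ?a \<or> z = ?b")
      case True then show ?thesis using i by auto
    next
      case False
      obtain k where k: "k < d" "W (\<tau> - {?a}) k = z" using W_surj[OF \<tau> ab(1) z] False by auto
      then have "k \<noteq> i" using False edge_W[OF \<tau> se(1)] by auto
      then show ?thesis using k se(2)[of k] by (auto intro!: image_eqI[of _ _ k])
    qed
  qed
  moreover have "split i \<tau> k \<in> \<tau>" if "k < Suc d" for k
  proof (cases "k = i \<or> k = d")
    case True then show ?thesis using ab by auto
  next
    case False
    then show ?thesis using se(2)[of k] W_in[OF \<tau> ab(1), of k] that by auto
  qed
  ultimately have im: "split i \<tau> ` {..<Suc d} = \<tau>" by auto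
  then have "inj_on (split i \<tau>) {..<Suc d}" using \<tau>(2) by (intro eq_card_imp_inj_on) auto
  then show "bij_betw (split i \<tau>) {..<Suc d} \<tau>" using im by (simp add: bij_betw_def)
next
  fix T k assume T: "T \<subseteq> L" "card T = Suc (Suc d)" and k: "k < Suc d"
  interpret linkage_field_pair L d W T using T by unfold_locales auto
  have sp: "split i (T - {x}) j = (if j = i then Min (E i x) else if j = d then Max (E i x)
      else om j x (Min (E i x)))" for x j
    by (simp add: split_def E_def om_eq)
  show "\<exists>x\<in>T. \<exists>y\<in>T. x \<noteq> y \<and>
      (\<forall>j<Suc d. j \<noteq> k \<longrightarrow> split i (T - {x}) j = split i (T - {y}) j)"
  proof (cases "k = i \<or> k = d")
    case True
    obtain p q s where pqs: "p \<in> T" "q \<in> T" "s \<in> T" "p < q" "q < s"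
      and Ei: "E i p = {q, s}" "E i q = {p, s}" "E i s = {p, q}"
      using triple_ex[OF i] .
    \<comment> \<open>The edges of \<open>p\<close> and \<open>q\<close> share the maximum
      \<open>s\<close>, which settles the label \<open>i\<close>; those of \<open>q\<close> and
      \<open>s\<close> share the minimum \<open>p\<close>, which settles the label
      \<open>d\<close>.\<close>
    have mm: "Min (E i p) = q" "Max (E i p) = s" "Min (E i q) = p" "Max (E i q) = s"
      "Min (E i s) = p" "Max (E i s) = q"
      using pqs by (auto simp: Ei min_def max_def)
    have "om j p q = om j q p" "om j q p = om j s p" if "j < d" "j \<noteq> i" for j
    proof -
      show "om j p q = om j q p" by (rule om_sym)
      have "om j p q = om j p s" using E_edge(4)[OF pqs(1) i, of q s j] Ei pqs that by auto
      then show "om j q p = om j s p" by (simp add: om_sym)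
    qed
    then have o: "om j q p = om j p q" "om j s p = om j p q" if "j < d" "j \<noteq> i" for j
      using that by metis+
    show ?thesis
    proof (cases "k = i")
      case True
      have "split i (T - {p}) j = split i (T - {q}) j" if "j < Suc d" "j \<noteq> k" for j
        using that True o[of j] by (auto simp: sp mm)
      then show ?thesis using pqs by (metis less_irrefl)
    next
      case False
      then have "k = d" using \<open>k = i \<or> k = d\<close> by simp
      have "split i (T - {q}) j = split i (T - {s}) j" if "j < Suc d" "j \<noteq> k" for j
        using that \<open>k = d\<close> o[of j] by (auto simp: sp mm)
      then show ?thesis using pqs by (metis less_irrefl)
    qed
  next
    case False
    then have k': "k < d" "k \<noteq> i" using k by auto
    obtain x y a where xya: "x \<in> T" "y \<in> T" "a \<in> T" "x \<noteq> y" "a \<in> E i x" "a \<in> E i y" "E k a = {x, y}"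
      using common_end_ex[OF i k'] .
    have ax: "a \<noteq> x" "a \<noteq> y" using E_sub[of a k] xya k' by auto
    have oa: "om j a x = om j a y" if "j < d" "j \<noteq> k" for j
      using E_edge(4)[OF xya(3) k'(1), of x y j] xya that by auto
    \<comment> \<open>\<open>b\<close> is the other end of the \<open>i\<close>-edge of
      \<open>x\<close>. As {x, y} is the \<open>k\<close>-edge of \<open>a\<close>, it is also that
      of \<open>y\<close>, so both split matchings treat \<open>i\<close> and its copy
      alike.\<close>
    define b where "b = om i x a"
    have b: "b \<in> E i x" "b \<noteq> a" using E_om[of x a i] om_in[of x a i] xya ax i unfolding b_def by auto
    have b2: "b = om i y a" using oa[OF i] k' unfolding b_def by (simp add: om_sym)
    have b3: "b \<in> E i y" using E_om[of y a i] xya ax unfolding b2 by auto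
    note ex = E_edge[OF xya(1) i xya(5) b(1) b(2)[symmetric]]
      and ey = E_edge[OF xya(2) i xya(6) b3 b(2)[symmetric]]
    have "om j x (Min {a, b}) = om j x a" "om j y (Min {a, b}) = om j y a" if "j < d" "j \<noteq> i" for j
      using ex(4)[OF that] ey(4)[OF that] by (auto simp: min_def)
    then have "split i (T - {x}) j = split i (T - {y}) j" if "j < Suc d" "j \<noteq> k" for j
      using that oa[of j] by (auto simp: sp ex(1) ey(1) om_sym)
    then show ?thesis using xya by metis
  qed
qed

end

subsection \<open>Compatible topes\<close>

text \<open>For a nonempty set of least size that \<open>h\<close> maps into itself, the image is
  again such a set and hence no smaller.\<close>

lemma ex_minimal_invariant:
  assumes "finite B" "B \<noteq> {}" "h ` B \<subseteq> B"
  obtains C where "C \<subseteq> B" "C \<noteq> {}" "h ` C = C"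
proof -
  define P where "P C \<longleftrightarrow> C \<noteq> {} \<and> C \<subseteq> B \<and> h ` C \<subseteq> C" for C
  have "P B" using assms by (simp add: P_def)
  then obtain C where "P C" and min: "\<forall>D. P D \<longrightarrow> card C \<le> card D"
    using ex_has_least_nat[of P B card] by blast
  then have C: "C \<noteq> {}" "C \<subseteq> B" "h ` C \<subseteq> C" by (auto simp: P_def)
  have "P (h ` C)" unfolding P_def using C by (intro conjI image_mono) auto
  then have "card C \<le> card (h ` C)" using min by blast
  then have "h ` C = C" by (intro card_seteq finite_subset[OF C(2) assms(1)] C(3))
  then show thesis by (rule that[OF C(2,1)])
qed

definition graph_on :: "nat set \<Rightarrow> (nat \<Rightarrow> nat) \<Rightarrow> (nat \<times> nat) set" where
  "graph_on S f = (\<lambda>l. (l, f l)) ` S"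

lemma graph_on_iff [simp]: "(l, r) \<in> graph_on S f \<longleftrightarrow> l \<in> S \<and> f l = r"
  by (auto simp: graph_on_def)

lemma graph_on_mono: "J \<subseteq> S \<Longrightarrow> graph_on J f \<subseteq> graph_on S f"
  by (auto simp: graph_on_def)

lemma perfect_matching_graph_on:
  assumes "inj_on f J"
  shows "perfect_matching J (f ` J) (graph_on J f)"
  using assms by (auto simp: perfect_matching_def graph_on_def inj_on_def)

text \<open>An alternating cycle in the union of two compatible graphs is trivial; it is found as a
  minimal set of right vertices that is invariant under the successor map.\<close>

lemma no_alternating_cycle:
  assumes comp: "compatible n d F1 F2" and S: "S \<subseteq> {0..<n}"
    and F: "graph_on S f \<subseteq> F1" "graph_on S g \<subseteq> F2"
    and B: "B \<subseteq> {0..<d}" "B \<noteq> {}"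
    and nxt: "\<And>r. r \<in> B \<Longrightarrow> \<exists>l\<in>S. f l = r \<and> g l \<in> B \<and> g l \<noteq> r"
  shows False
proof -
  obtain \<sigma> where \<sigma>: "\<And>r. r \<in> B \<Longrightarrow> \<sigma> r \<in> S \<and> f (\<sigma> r) = r \<and> g (\<sigma> r) \<in> B \<and> g (\<sigma> r) \<noteq> r"
    using nxt by metis
  have "finite B" using B finite_subset by auto
  moreover have "(g \<circ> \<sigma>) ` B \<subseteq> B" using \<sigma> by auto
  ultimately obtain C where C: "C \<subseteq> B" "C \<noteq> {}" "(g \<circ> \<sigma>) ` C = C"
    using ex_minimal_invariant[OF _ B(2)] by metis
  have finC: "finite C" using C(1) \<open>finite B\<close> finite_subset by auto
  define J where "J = \<sigma> ` C"
  have J: "J \<subseteq> S" using C \<sigma> unfolding J_def by auto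
  have "f ` J = id ` C" using C(1) \<sigma> unfolding J_def image_image by (intro image_cong) auto
  then have fJ: "f ` J = C" by simp
  have gJ: "g ` J = C" using C(3) unfolding J_def by (simp add: image_comp)
  have finJ: "finite J" using finC unfolding J_def by simp
  \<comment> \<open>\<open>f\<close> maps \<open>J\<close> onto \<open>C\<close>, so the sizes agree
    and both \<open>f\<close> and \<open>g\<close> are bijections from \<open>J\<close> to
    \<open>C\<close>.\<close>
  have "card J = card C"
    using card_image_le[OF finC, of \<sigma>] card_image_le[OF finJ, of f] fJ unfolding J_def by simp
  then have inj: "inj_on f J" "inj_on g J" using finJ fJ gJ by (auto intro: eq_card_imp_inj_on)
  have "graph_on J f \<subseteq> F1" "graph_on J g \<subseteq> F2" using F graph_on_mono[OF J] by blast+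
  moreover have "perfect_matching J C (graph_on J f)" "perfect_matching J C (graph_on J g)"
    using perfect_matching_graph_on[OF inj(1)] perfect_matching_graph_on[OF inj(2)]
    unfolding fJ gJ by auto
  moreover have "J \<subseteq> {0..<n}" "C \<subseteq> {0..<d}" using J S C(1) B(1) by auto
  ultimately have "graph_on J f = graph_on J g" using comp unfolding compatible_def by blast
  moreover obtain r where r: "r \<in> C" using C by auto
  then have "(\<sigma> r, f (\<sigma> r)) \<in> graph_on J f" unfolding J_def by simp
  ultimately have "g (\<sigma> r) = f (\<sigma> r)" by (metis graph_on_iff)
  then show False using \<sigma>[of r] r C by auto
qed

text \<open>Consider the right vertices that lose an element in passing from \<open>f\<close> to
  \<open>g\<close>. A vertex other than \<open>j\<close> that gains one must also lose one, as its
  fibre does not grow; if \<open>j\<close> lost one too, the exchange would close up to an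
  alternating cycle.\<close>

lemma compatible_fibre_mono:
  assumes comp: "compatible n d F1 F2" and S: "S \<subseteq> {0..<n}"
    and F: "graph_on S f \<subseteq> F1" "graph_on S g \<subseteq> F2"
    and val: "\<And>l. l \<in> S \<Longrightarrow> f l < d" "\<And>l. l \<in> S \<Longrightarrow> g l < d"
    and le: "\<And>r. \<lbrakk>r < d; r \<noteq> j\<rbrakk> \<Longrightarrow> card {l \<in> S. g l = r} \<le> card {l \<in> S. f l = r}"
    and l: "l \<in> S" "f l = j"
  shows "g l = j"
proof (rule ccontr)
  assume neq: "g l \<noteq> j"
  define B where "B = {f l | l. l \<in> S \<and> g l \<noteq> f l}"
  have jB: "j \<in> B" using l neq unfolding B_def by auto
  have "g l' \<in> B" if l': "l' \<in> S" "g l' \<noteq> f l'" for l'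
  proof (cases "g l' = j")
    case True then show ?thesis using jB by simp
  next
    case False
    let ?r = "g l'"
    have fin: "finite {l \<in> S. g l = ?r}" "finite {l \<in> S. f l = ?r}"
      using finite_subset[OF S] by auto
    have "\<not> {l \<in> S. f l = ?r} \<subseteq> {l \<in> S. g l = ?r}"
    proof
      assume "{l \<in> S. f l = ?r} \<subseteq> {l \<in> S. g l = ?r}"
      then have "{l \<in> S. f l = ?r} = {l \<in> S. g l = ?r}"
        using card_seteq[OF fin(1)] le[OF val(2)[OF l'(1)] False] by blast
      moreover have "l' \<in> {l \<in> S. g l = ?r}" using l' by simp
      ultimately have "l' \<in> {l \<in> S. f l = ?r}" by blast
      then show False using l' by simp
    qed
    then show ?thesis unfolding B_def by force
  qed
  then have "\<exists>l\<in>S. f l = r \<and> g l \<in> B \<and> g l \<noteq> r" if "r \<in> B" for r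
    using that unfolding B_def by blast
  moreover have "B \<subseteq> {0..<d}" "B \<noteq> {}" using val jB unfolding B_def by auto
  ultimately show False using no_alternating_cycle[OF comp S F] by metis
qed

lemma maximal_tope_graph:
  assumes "maximal_tope n d F"
  obtains f where "F = graph_on {0..<n} f" "\<And>l. l < n \<Longrightarrow> f l < d"
    "\<And>r. r < d \<Longrightarrow> \<exists>l<n. f l = r"
proof -
  have F: "F \<subseteq> {0..<n} \<times> {0..<d}" "\<And>l. l < n \<Longrightarrow> card {r. (l, r) \<in> F} = 1"
    "\<And>r. r < d \<Longrightarrow> card {l. (l, r) \<in> F} > 0"
    using assms unfolding maximal_tope_def bgraph_def ldeg_def rdeg_def by auto
  have "\<exists>r. {r. (l, r) \<in> F} = {r}" if "l < n" for l
    using F(2)[OF that] by (simp add: card_1_singleton_iff)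
  then obtain f where f: "\<And>l. l < n \<Longrightarrow> {r. (l, r) \<in> F} = {f l}" by metis
  have FG: "F = graph_on {0..<n} f"
  proof (rule set_eqI)
    fix e :: "nat \<times> nat"
    obtain l r where e: "e = (l, r)" by fastforce
    show "e \<in> F \<longleftrightarrow> e \<in> graph_on {0..<n} f"
    proof (cases "l < n")
      case True
      have "(l, r) \<in> F \<longleftrightarrow> r \<in> {f l}" unfolding f[OF True, symmetric] by simp
      then show ?thesis using True unfolding e by auto
    next
      case False
      then show ?thesis using F(1) unfolding e by auto
    qed
  qed
  show thesis
  proof (rule that[of f])
    show "F = graph_on {0..<n} f" by (fact FG)
    show "f l < d" if "l < n" for l
    proof -
      have "(l, f l) \<in> F" using that FG by simp
      then show ?thesis using F(1) by auto
    qed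
    show "\<exists>l<n. f l = r" if "r < d" for r
    proof -
      have "{l. (l, r) \<in> F} \<noteq> {}" using F(3)[OF that] by (auto simp: card_gt_0_iff)
      then show ?thesis using FG by auto
    qed
  qed
qed

lemma rdeg_graph_on: "rdeg (graph_on S f) r = card {l \<in> S. f l = r}"
  by (simp add: rdeg_def)

lemma maximal_tope_graph_on:
  assumes "\<And>l. l < n \<Longrightarrow> f l < d" "\<And>r. r < d \<Longrightarrow> card {l \<in> {0..<n}. f l = r} > 0"
  shows "maximal_tope n d (graph_on {0..<n} f)"
proof -
  have "{r. (l, r) \<in> graph_on {0..<n} f} = {f l}" if "l < n" for l using that by auto
  moreover have "graph_on {0..<n} f \<subseteq> {0..<n} \<times> {0..<d}"
    using assms(1) by (auto simp: graph_on_def)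
  ultimately show ?thesis
    using assms(2) unfolding maximal_tope_def bgraph_def rdeg_graph_on by (simp add: ldeg_def)
qed

lemma rdeg_vec_pos_points:
  assumes "maximal_tope n d F"
  shows "rdeg_vec d F \<in> pos_points n d"
proof -
  obtain f where f: "F = graph_on {0..<n} f" "\<And>l. l < n \<Longrightarrow> f l < d"
    using maximal_tope_graph[OF assms] by metis
  have "(\<Sum>i<d. rdeg F i) = (\<Sum>i<d. \<Sum>l\<in>{l \<in> {0..<n}. f l = i}. 1)"
    by (simp add: f(1) rdeg_graph_on)
  also have "\<dots> = (\<Sum>l\<in>{0..<n}. 1)" by (rule sum.group) (use f in auto)
  finally have "(\<Sum>i<d. rdeg F i) = n" by simp
  then show ?thesis
    using assms unfolding pos_points_def rdeg_vec_def maximal_tope_def by simp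
qed

text \<open>Every right vertex outside \<open>I\<close> has a neighbour, and left degrees are one,
  so choosing neighbours never creates a conflict. This reduces compatibility to matchings that
  cover all right vertices.\<close>

lemma tope_extend_matching:
  assumes F: "maximal_tope n d F" and M: "perfect_matching J I M" "M \<subseteq> F" "I \<subseteq> {0..<d}"
  obtains \<sigma> N where "dsubset n d \<sigma>" "perfect_matching \<sigma> {0..<d} N" "N \<subseteq> F" "M \<subseteq> N"
proof -
  obtain f where f: "F = graph_on {0..<n} f" "\<And>r. r < d \<Longrightarrow> \<exists>l<n. f l = r"
    using maximal_tope_graph[OF F] by metis
  have "\<exists>l<n. f l = r \<and> (r \<in> I \<longrightarrow> (l, r) \<in> M)" if "r < d" for r
  proof (cases "r \<in> I")
    case True
    then obtain l where "(l, r) \<in> M" using M(1) unfolding perfect_matching_def by blast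
    moreover from this have "(l, r) \<in> graph_on {0..<n} f" using M(2) f(1) by blast
    ultimately show ?thesis by auto
  qed (use f(2)[OF that] in auto)
  then obtain s where s: "\<And>r. r < d \<Longrightarrow> s r < n \<and> f (s r) = r \<and> (r \<in> I \<longrightarrow> (s r, r) \<in> M)"
    by metis
  define \<sigma> where "\<sigma> = s ` {0..<d}"
  have inj: "inj_on s {0..<d}" using s by (metis atLeastLessThan_iff inj_onI)
  have f\<sigma>: "f ` \<sigma> = {0..<d}" using s unfolding \<sigma>_def by (force simp: image_iff)
  have card: "card \<sigma> = d" using card_image[OF inj] unfolding \<sigma>_def by simp
  have "inj_on f \<sigma>" using f\<sigma> card by (intro eq_card_imp_inj_on) (auto simp: \<sigma>_def)
  then have pm: "perfect_matching \<sigma> {0..<d} (graph_on \<sigma> f)"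
    using perfect_matching_graph_on f\<sigma> by metis
  have \<sigma>n: "\<sigma> \<subseteq> {0..<n}" using s unfolding \<sigma>_def by auto
  have "M \<subseteq> graph_on \<sigma> f"
  proof safe
    fix l r assume lr: "(l, r) \<in> M"
    then have r: "r \<in> I" "r < d" using M unfolding perfect_matching_def by auto
    then have "l = s r" using s[OF r(2)] lr M(1) unfolding perfect_matching_def by blast
    then show "(l, r) \<in> graph_on \<sigma> f" using s[OF r(2)] r unfolding \<sigma>_def by auto
  qed
  moreover have "graph_on \<sigma> f \<subseteq> F" using graph_on_mono[OF \<sigma>n] f(1) by simp
  ultimately show thesis using that[of \<sigma>] pm \<sigma>n card unfolding dsubset_def by blast
qed

section \<open>Perfect matchings as maps from right to left vertices\<close>

definition left_end :: "(nat \<times> nat) set \<Rightarrow> nat \<Rightarrow> nat" where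
  "left_end M k = (THE l. (l, k) \<in> M)"

lemma left_end_iff:
  assumes "perfect_matching J I M"
  shows "(l, k) \<in> M \<longleftrightarrow> k \<in> I \<and> l = left_end M k"
proof -
  have "\<exists>!l. (l, k) \<in> M" if "k \<in> I" using assms that unfolding perfect_matching_def by blast
  then have "k \<in> I \<Longrightarrow> (l, k) \<in> M \<longleftrightarrow> l = left_end M k"
    unfolding left_end_def by (metis theI)
  moreover have "(l, k) \<in> M \<Longrightarrow> k \<in> I" using assms unfolding perfect_matching_def by auto
  ultimately show ?thesis by blast
qed

lemma left_end_bij:
  assumes "perfect_matching J I M"
  shows "bij_betw (left_end M) I J"
proof -
  have 1: "(left_end M k, k) \<in> M" if "k \<in> I" for k using left_end_iff[OF assms] that by blast
  have 2: "M \<subseteq> J \<times> I" "\<And>j. j \<in> J \<Longrightarrow> \<exists>!i. (j, i) \<in> M"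
    using assms unfolding perfect_matching_def by auto
  have "inj_on (left_end M) I"
  proof (rule inj_onI)
    fix x y assume xy: "x \<in> I" "y \<in> I" "left_end M x = left_end M y"
    then have "(left_end M x, x) \<in> M" "(left_end M x, y) \<in> M" using 1[of x] 1[of y] by auto
    then show "x = y" using 2 by blast
  qed
  moreover have "left_end M ` I = J"
  proof
    show "left_end M ` I \<subseteq> J" using 1 2(1) by auto
    show "J \<subseteq> left_end M ` I"
    proof
      fix j assume "j \<in> J"
      then obtain i where "(j, i) \<in> M" using 2 by blast
      then show "j \<in> left_end M ` I" using left_end_iff[OF assms] by blast
    qed
  qed
  ultimately show ?thesis by (simp add: bij_betw_def)
qed

lemma left_end_subset:
  assumes "perfect_matching J I M" "perfect_matching J' I' M'" "M \<subseteq> M'" "k \<in> I"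
  shows "left_end M' k = left_end M k"
proof -
  have "(left_end M k, k) \<in> M'" using left_end_iff[OF assms(1)] assms(3,4) by blast
  then show ?thesis using left_end_iff[OF assms(2)] by simp
qed

lemma perfect_matching_eqI:
  assumes "perfect_matching J I M" "perfect_matching J' I M'"
    and "\<And>k. k \<in> I \<Longrightarrow> left_end M k = left_end M' k"
  shows "M = M'"
proof (rule set_eqI)
  fix e :: "nat \<times> nat"
  obtain l k where "e = (l, k)" by fastforce
  then show "e \<in> M \<longleftrightarrow> e \<in> M'"
    using left_end_iff[OF assms(1), of l k] left_end_iff[OF assms(2), of l k] assms(3)[of k] by auto
qed

lemma linkage_imp_linkage_field:
  assumes "linkage n d M"
  shows "linkage_field {0..<n} d (\<lambda>\<sigma>. left_end (M \<sigma>))"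
proof
  have pm: "perfect_matching \<sigma> {0..<d} (M \<sigma>)" if "dsubset n d \<sigma>" for \<sigma>
    using assms that unfolding linkage_def matching_field_def by blast
  show "finite {0..<n}" by simp
  show "bij_betw (left_end (M \<sigma>)) {..<d} \<sigma>" if "\<sigma> \<subseteq> {0..<n}" "card \<sigma> = d" for \<sigma>
    using left_end_bij[OF pm[of \<sigma>]] that by (simp add: dsubset_def atLeast0LessThan)
  fix \<tau> :: "nat set" and i assume \<tau>: "\<tau> \<subseteq> {0..<n}" "card \<tau> = Suc d" and i: "i < d"
  have "dsubset n (d + 1) \<tau>" using \<tau> by (simp add: dsubset_def)
  then have "\<exists>j\<in>\<tau>. \<exists>j'\<in>\<tau>. j \<noteq> j' \<and>
      {e \<in> M (\<tau> - {j}). snd e \<noteq> i} = {e \<in> M (\<tau> - {j'}). snd e \<noteq> i}"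
    using assms i unfolding linkage_def by blast
  then obtain j j' where j: "j \<in> \<tau>" "j' \<in> \<tau>" "j \<noteq> j'"
    and eq: "{e \<in> M (\<tau> - {j}). snd e \<noteq> i} = {e \<in> M (\<tau> - {j'}). snd e \<noteq> i}"
    by blast
  have sub: "dsubset n d (\<tau> - {x})" if "x \<in> \<tau>" for x
    using \<tau> that finite_subset[OF \<tau>(1)] unfolding dsubset_def by auto
  have "left_end (M (\<tau> - {j})) k = left_end (M (\<tau> - {j'})) k" if "k < d" "k \<noteq> i" for k
  proof -
    have "(left_end (M (\<tau> - {j})) k, k) \<in> M (\<tau> - {j})"
      using left_end_iff[OF pm[OF sub[OF j(1)]]] that by simp
    then have "(left_end (M (\<tau> - {j})) k, k) \<in> {e \<in> M (\<tau> - {j}). snd e \<noteq> i}" using that by simp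
    then have "(left_end (M (\<tau> - {j})) k, k) \<in> M (\<tau> - {j'})" unfolding eq by simp
    then show ?thesis using left_end_iff[OF pm[OF sub[OF j(2)]]] by simp
  qed
  then show "\<exists>a\<in>\<tau>. \<exists>b\<in>\<tau>. a \<noteq> b \<and>
      (\<forall>k<d. k \<noteq> i \<longrightarrow> left_end (M (\<tau> - {a})) k = left_end (M (\<tau> - {b})) k)"
    using j by blast
qed

section \<open>Iterated splitting to prescribed right degrees\<close>

context linkage_field
begin

text \<open>\<open>p\<close> sends each copy to the right vertex it was split from; the last condition says that
  choosing one copy \<open>s k\<close> of every right vertex \<open>k\<close> recovers a matching of the original field.\<close>

definition refinement :: "(nat \<Rightarrow> nat) \<Rightarrow> nat \<Rightarrow> ('a set \<Rightarrow> nat \<Rightarrow> 'a) \<Rightarrow> (nat \<Rightarrow> nat) \<Rightarrow> bool" where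
  "refinement v m V p \<longleftrightarrow> linkage_field L m V \<and> (\<forall>j<m. p j < d) \<and>
    (\<forall>i<d. card {j. j < m \<and> p j = i} = v i) \<and>
    (\<forall>\<tau> s k. \<tau> \<subseteq> L \<longrightarrow> card \<tau> = m \<longrightarrow> (\<forall>k<d. s k < m \<and> p (s k) = k) \<longrightarrow> k < d \<longrightarrow>
      W ((\<lambda>k. V \<tau> (s k)) ` {..<d}) k = V \<tau> (s k))"

lemma refinementD:
  assumes "refinement v m V p"
  shows "linkage_field L m V" "\<And>j. j < m \<Longrightarrow> p j < d"
    "\<And>i. i < d \<Longrightarrow> card {j. j < m \<and> p j = i} = v i"
    "\<And>\<tau> s k. \<lbrakk>\<tau> \<subseteq> L; card \<tau> = m; \<forall>k<d. s k < m \<and> p (s k) = k; k < d\<rbrakk> \<Longrightarrow>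
      W ((\<lambda>k. V \<tau> (s k)) ` {..<d}) k = V \<tau> (s k)"
  using assms unfolding refinement_def by auto

text \<open>Induction on the number of splittings: lower some degree that is at least two, refine
  for the smaller vector, then split any copy of that right vertex.\<close>

lemma iterated_split:
  assumes "\<And>i. i < d \<Longrightarrow> v i > 0" and "(\<Sum>i<d. v i) = d + m"
  shows "\<exists>V p. refinement v (d + m) V p"
  using assms
proof (induction m arbitrary: v)
  case 0
  have "v i = 1" if "i < d" for i
  proof (rule ccontr)
    assume "v i \<noteq> 1"
    then have "1 < v i" using 0(1)[OF that] by simp
    then have "(\<Sum>i<d. 1) < (\<Sum>i<d. v i)" using 0(1) that by (intro sum_strict_mono_ex1) (auto simp: Suc_le_eq)
    then show False using 0(2) by simp
  qed
  moreover have "{j. j < d \<and> j = i} = {i}" if "i < d" for i using that by auto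
  moreover have "W ((\<lambda>k. W \<tau> (s k)) ` {..<d}) k = W \<tau> (s k)"
    if "\<tau> \<subseteq> L" "card \<tau> = d" "\<forall>k<d. s k < d \<and> s k = k" "k < d" for \<tau> s k
  proof -
    have "(\<lambda>k. W \<tau> (s k)) ` {..<d} = W \<tau> ` {..<d}" using that(3) by (intro image_cong) auto
    also have "\<dots> = \<tau>" using bij[OF that(1,2)] by (simp add: bij_betw_def)
    finally show ?thesis using that by simp
  qed
  ultimately have "refinement v (d + 0) W (\<lambda>j. j)"
    unfolding refinement_def using linkage_field_axioms by simp
  then show ?case by blast
next
  case (Suc m)
  have "\<exists>i<d. v i \<ge> 2"
  proof (rule ccontr)
    assume "\<not> ?thesis"
    then have "(\<Sum>i<d. v i) \<le> (\<Sum>i<d. 1)" by (intro sum_mono) force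
    then show False using Suc.prems(2) by simp
  qed
  then obtain i where i: "i < d" "v i \<ge> 2" by blast
  define u where "u = v(i := v i - 1)"
  have "(\<Sum>j<d. v j) = v i + (\<Sum>j\<in>{..<d} - {i}. v j)"
    "(\<Sum>j<d. u j) = u i + (\<Sum>j\<in>{..<d} - {i}. u j)"
    using i(1) by (simp_all add: sum.remove)
  moreover have "(\<Sum>j\<in>{..<d} - {i}. u j) = (\<Sum>j\<in>{..<d} - {i}. v j)"
    by (intro sum.cong) (auto simp: u_def)
  ultimately have sumu: "(\<Sum>j<d. u j) = d + m"
    using Suc.prems(2) i(2) by (simp add: u_def)
  have "\<And>j. j < d \<Longrightarrow> u j > 0" using Suc.prems(1) i(2) by (simp add: u_def)
  from Suc.IH[OF this sumu] obtain V p where Vp: "refinement u (d + m) V p" by blast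
  note p = refinementD(2,3)[OF Vp] and sec = refinementD(4)[OF Vp]
  interpret V: linkage_field L "d + m" V by (rule refinementD(1)[OF Vp])
  have "card {j. j < d + m \<and> p j = i} > 0" using p(2)[OF i(1)] i(2) by (simp add: u_def)
  then obtain i' where i': "i' < d + m" "p i' = i" by (auto simp: card_gt_0_iff)
  define p' where "p' = p(d + m := i)"
  let ?V = "V.split i'"
  have "linkage_field L (d + Suc m) ?V" using V.linkage_field_split[OF i'(1)] by simp
  moreover have "p' j < d" if "j < d + Suc m" for j
    using that p(1)[of j] i(1) by (auto simp: p'_def)
  moreover have "card {j. j < d + Suc m \<and> p' j = k} = v k" if k: "k < d" for k
  proof (cases "k = i")
    case True
    have "{j. j < d + Suc m \<and> p' j = k} = insert (d + m) {j. j < d + m \<and> p j = i}"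
      using True by (auto simp: p'_def)
    then have "card {j. j < d + Suc m \<and> p' j = k} = Suc (card {j. j < d + m \<and> p j = i})" by simp
    then show ?thesis using True p(2)[OF i(1)] i(2) by (simp add: u_def)
  next
    case False
    then have "{j. j < d + Suc m \<and> p' j = k} = {j. j < d + m \<and> p j = k}"
      by (auto simp: p'_def)
    then show ?thesis using p(2)[OF k] False by (simp add: u_def)
  qed
  moreover have "W ((\<lambda>k. ?V \<tau> (s k)) ` {..<d}) k = ?V \<tau> (s k)"
    if \<tau>: "\<tau> \<subseteq> L" "card \<tau> = d + Suc m" and s: "\<forall>k<d. s k < d + Suc m \<and> p' (s k) = k" and k: "k < d"
    for \<tau> s k
  proof -
    have \<tau>': "card \<tau> = Suc (d + m)" using \<tau>(2) by simp
    have sp: "s k < d + m \<and> p (s k) = k" if "k < d" "k \<noteq> i" for k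
    proof -
      have "s k < d + Suc m" "p' (s k) = k" using s that(1) by auto
      then show ?thesis using that(2) unfolding p'_def by (cases "s k = d + m") auto
    qed
    \<comment> \<open>Leaving out one left vertex \<open>z\<close> turns a choice of copies after
      the split into a choice before it.\<close>
    have redV: "W ((\<lambda>k. ?V \<tau> (s k)) ` {..<d}) k = ?V \<tau> (s k)"
      if z: "z \<in> \<tau>" and s': "\<forall>k<d. s' k < d + m \<and> p (s' k) = k"
        and eq: "\<And>k. k < d \<Longrightarrow> ?V \<tau> (s k) = V (\<tau> - {z}) (s' k)" for z s'
    proof -
      have im: "(\<lambda>k. ?V \<tau> (s k)) ` {..<d} = (\<lambda>k. V (\<tau> - {z}) (s' k)) ` {..<d}"
        using eq by (intro image_cong) auto
      have "\<tau> - {z} \<subseteq> L" "card (\<tau> - {z}) = d + m"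
        using \<tau>(1) \<tau>' z finite_subset[OF \<tau>(1) finL] by auto
      from sec[OF this s' k] show ?thesis unfolding im eq[OF k] .
    qed
    have e: "V.edge \<tau> i' (?V \<tau> i') (?V \<tau> (d + m))" by (rule V.split_edge(1)[OF \<tau>(1) \<tau>' i'(1)])
    \<comment> \<open>The left vertex to leave out belongs to whichever of the two copies
      \<open>s\<close> does not use: the new copy, or \<open>i'\<close>. In the latter case
      \<open>i'\<close> takes over the end held by the new copy.\<close>
    show ?thesis
    proof (cases "s i = d + m")
      case False
      then have si: "s i < d + m" "p (s i) = i" using s i(1) by (auto simp: p'_def)
      have s': "\<forall>k<d. s k < d + m \<and> p (s k) = k" using sp si by metis
      show ?thesis
      proof (rule redV[OF _ s'])
        show "?V \<tau> (d + m) \<in> \<tau>" using e by (simp add: V.edge_def)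
        show "?V \<tau> (s k) = V (\<tau> - {?V \<tau> (d + m)}) (s k)" if "k < d" for k
          using V.split_minus_copy[OF \<tau>(1) \<tau>' i'(1)] s' that by blast
      qed
    next
      case True
      have s': "\<forall>k<d. (s(i := i')) k < d + m \<and> p ((s(i := i')) k) = k" using sp i' by simp
      show ?thesis
      proof (rule redV[OF _ s'])
        show "?V \<tau> i' \<in> \<tau>" using e by (simp add: V.edge_def)
        show "?V \<tau> (s k) = V (\<tau> - {?V \<tau> i'}) ((s(i := i')) k)" if "k < d" for k
        proof (cases "k = i")
          case kTrue: True
          then show ?thesis
            using True V.edge_W[OF \<tau>(1) \<tau>' e] by simp
        next
          case False
          then have "s k < d + m" "s k \<noteq> i'" using sp[OF that False] i' by auto
          then show ?thesis using V.split_edge(2)[OF \<tau>(1) \<tau>' i'(1)] False by simp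
        qed
      qed
    qed
  qed
  ultimately have "refinement v (d + Suc m) ?V p'" unfolding refinement_def by blast
  then show ?case by blast
qed

end

subsection \<open>The tope arrangement of a linkage field\<close>

lemma linkage_matching:
  assumes "linkage n d M" "dsubset n d \<sigma>"
  shows "perfect_matching \<sigma> {0..<d} (M \<sigma>)"
  using assms unfolding linkage_def matching_field_def by blast

lemma linkage_submatching_unique:
  assumes M: "linkage n d M" and \<sigma>: "dsubset n d \<sigma>" "dsubset n d \<sigma>'"
    and I: "I \<subseteq> {0..<d}"
    and N: "perfect_matching J I N" "N \<subseteq> M \<sigma>" "perfect_matching J I N'" "N' \<subseteq> M \<sigma>'"
  shows "N = N'"
proof (rule perfect_matching_eqI[OF N(1,3)])
  fix k assume k: "k \<in> I"
  interpret linkage_field "{0..<n}" d "\<lambda>\<sigma>. left_end (M \<sigma>)"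
    by (rule linkage_imp_linkage_field[OF M])
  have 1: "left_end (M \<sigma>) j = left_end N j" "left_end (M \<sigma>') j = left_end N' j" if "j \<in> I" for j
    using left_end_subset[OF N(1) linkage_matching[OF M \<sigma>(1)] N(2) that]
      left_end_subset[OF N(3) linkage_matching[OF M \<sigma>(2)] N(4) that] by auto
  have "left_end (M \<sigma>) ` I = left_end N ` I" "left_end (M \<sigma>') ` I = left_end N' ` I"
    using 1 by (auto intro: image_cong)
  then have "left_end (M \<sigma>) ` I = left_end (M \<sigma>') ` I"
    using left_end_bij[OF N(1)] left_end_bij[OF N(3)] by (simp add: bij_betw_def)
  then have "left_end (M \<sigma>) k = left_end (M \<sigma>') k"
    using matchings_compatible[of \<sigma> \<sigma>' I k] \<sigma> I k by (simp add: dsubset_def atLeast0LessThan)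
  then show "left_end N k = left_end N' k" using 1[OF k] by simp
qed

lemma field_matching_if_compatible:
  assumes "perfect_matching \<sigma> {0..<d} N" "N \<subseteq> F" "compatible n d F M"
    and "dsubset n d \<sigma>" "perfect_matching \<sigma> {0..<d} M"
  shows "N = M"
  using assms unfolding compatible_def dsubset_def by blast

text \<open>Both submatchings extend, inside their topes, to matchings of the field, where
  \<open>linkage_submatching_unique\<close> compares them.\<close>

lemma compatible_if_matchings_in_field:
  assumes M: "linkage n d M" and F: "maximal_tope n d F1" "maximal_tope n d F2"
    and sec: "\<And>\<sigma> N. \<lbrakk>dsubset n d \<sigma>; perfect_matching \<sigma> {0..<d} N; N \<subseteq> F1 \<or> N \<subseteq> F2\<rbrakk> \<Longrightarrow> N = M \<sigma>"
  shows "compatible n d F1 F2"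
  unfolding compatible_def
proof (intro allI impI, elim conjE)
  fix J I M1 M2
  assume I: "I \<subseteq> {0..<d}" and M1: "perfect_matching J I M1" "M1 \<subseteq> F1"
    and M2: "perfect_matching J I M2" "M2 \<subseteq> F2"
  obtain \<sigma>1 N1 where 1: "dsubset n d \<sigma>1" "perfect_matching \<sigma>1 {0..<d} N1" "N1 \<subseteq> F1" "M1 \<subseteq> N1"
    using tope_extend_matching[OF F(1) M1 I] .
  obtain \<sigma>2 N2 where 2: "dsubset n d \<sigma>2" "perfect_matching \<sigma>2 {0..<d} N2" "N2 \<subseteq> F2" "M2 \<subseteq> N2"
    using tope_extend_matching[OF F(2) M2 I] .
  have "N1 = M \<sigma>1" "N2 = M \<sigma>2" using sec[OF 1(1,2)] sec[OF 2(1,2)] 1(3) 2(3) by auto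
  then show "M1 = M2"
    using linkage_submatching_unique[OF M 1(1) 2(1) I M1(1) _ M2(1)] 1(4) 2(4) by simp
qed

lemma compatible_with_matching:
  assumes M: "linkage n d M" and F: "maximal_tope n d F"
    and sec: "\<And>\<sigma> N. \<lbrakk>dsubset n d \<sigma>; perfect_matching \<sigma> {0..<d} N; N \<subseteq> F\<rbrakk> \<Longrightarrow> N = M \<sigma>"
    and \<rho>: "dsubset n d \<rho>"
  shows "compatible n d F (M \<rho>)"
  unfolding compatible_def
proof (intro allI impI, elim conjE)
  fix J I M1 M2
  assume I: "I \<subseteq> {0..<d}" and M1: "perfect_matching J I M1" "M1 \<subseteq> F"
    and M2: "perfect_matching J I M2" "M2 \<subseteq> M \<rho>"
  obtain \<sigma> N where 1: "dsubset n d \<sigma>" "perfect_matching \<sigma> {0..<d} N" "N \<subseteq> F" "M1 \<subseteq> N"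
    using tope_extend_matching[OF F M1 I] .
  then have "M1 \<subseteq> M \<sigma>" using sec[OF 1(1-3)] by simp
  then show "M1 = M2" by (rule linkage_submatching_unique[OF M 1(1) \<rho> I M1(1) _ M2])
qed

lemma tope_of_degree_ex:
  assumes M: "linkage n d M" and v: "v \<in> pos_points n d"
  obtains F where "maximal_tope n d F" "rdeg_vec d F = v"
    "\<And>\<sigma>. dsubset n d \<sigma> \<Longrightarrow> compatible n d F (M \<sigma>)"
proof -
  interpret linkage_field "{0..<n}" d "\<lambda>\<sigma>. left_end (M \<sigma>)"
    by (rule linkage_imp_linkage_field[OF M])
  have vpos: "\<And>i. i < d \<Longrightarrow> v i > 0" and vout: "\<And>i. i \<ge> d \<Longrightarrow> v i = 0"
    and vsum: "(\<Sum>i<d. v i) = n"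
    using v unfolding pos_points_def by auto
  have "(\<Sum>i<d. 1) \<le> (\<Sum>i<d. v i)" using vpos by (intro sum_mono) (auto simp: Suc_le_eq)
  then have dn: "d \<le> n" using vsum by simp
  then have "(\<Sum>i<d. v i) = d + (n - d)" using vsum by simp
  from iterated_split[OF vpos this] dn obtain V p where Vp: "refinement v n V p" by auto
  note p = refinementD(2,3)[OF Vp] and sec = refinementD(4)[OF Vp]
  define w where "w = V {0..<n}"
  have bw: "bij_betw w {..<n} {0..<n}"
    unfolding w_def by (rule linkage_field.bij[OF refinementD(1)[OF Vp]]) auto
  \<comment> \<open>Each left vertex is matched to one of the \<open>n\<close> copies and is
    attached to the right vertex that this copy came from.\<close>
  define f where "f l = p (the_inv_into {..<n} w l)" for l
  have fw: "f (w j) = p j" if "j < n" for j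
    using the_inv_into_f_f[of w "{..<n}" j] bw that by (simp add: f_def bij_betw_def)
  have wn: "w j < n" if "j < n" for j using bw that unfolding bij_betw_def by auto
  have w_ex: "\<exists>j<n. l = w j" if "l < n" for l
  proof -
    have "l \<in> w ` {..<n}" using bw that unfolding bij_betw_def by simp
    then show ?thesis by auto
  qed
  have fibre: "card {l \<in> {0..<n}. f l = i} = v i" if "i < d" for i
  proof -
    have "{l \<in> {0..<n}. f l = i} = w ` {j. j < n \<and> p j = i}"
    proof (intro subset_antisym subsetI)
      fix l assume "l \<in> {l \<in> {0..<n}. f l = i}"
      moreover from this obtain j where "j < n" "l = w j" using w_ex[of l] by auto
      ultimately show "l \<in> w ` {j. j < n \<and> p j = i}" using fw[of j] by auto
    qed (use fw wn in auto)
    moreover have "inj_on w {j. j < n \<and> p j = i}"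
      using bw by (auto simp: bij_betw_def intro: inj_on_subset)
    ultimately show ?thesis using card_image p(2)[OF that] by metis
  qed
  define F where "F = graph_on {0..<n} f"
  have fd: "f l < d" if "l < n" for l using w_ex[OF that] fw p(1) by auto
  have tope: "maximal_tope n d F"
    unfolding F_def by (rule maximal_tope_graph_on) (use fd fibre vpos in auto)
  \<comment> \<open>A matching inside the tope that covers all right vertices selects one copy of
    each, so the refinement identifies it with a matching of the field.\<close>
  have "N = M \<sigma>" if \<sigma>: "dsubset n d \<sigma>" and N: "perfect_matching \<sigma> {0..<d} N" "N \<subseteq> F" for \<sigma> N
  proof -
    have "\<exists>j<n. p j = k \<and> w j = left_end N k" if "k < d" for k
    proof -
      have "(left_end N k, k) \<in> N" using left_end_iff[OF N(1)] that by simp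
      then have l: "left_end N k < n" "f (left_end N k) = k" using N(2) unfolding F_def by auto
      then obtain j where "j < n" "left_end N k = w j" using w_ex by blast
      then show ?thesis using fw l(2) by auto
    qed
    then obtain s where s: "\<And>k. k < d \<Longrightarrow> s k < n \<and> p (s k) = k \<and> w (s k) = left_end N k" by metis
    have "(\<lambda>k. w (s k)) ` {..<d} = left_end N ` {..<d}" using s by (intro image_cong) auto
    also have "\<dots> = \<sigma>" using left_end_bij[OF N(1)] by (simp add: bij_betw_def atLeast0LessThan)
    finally have im: "(\<lambda>k. w (s k)) ` {..<d} = \<sigma>" .
    show ?thesis
    proof (rule perfect_matching_eqI[OF N(1) linkage_matching[OF M \<sigma>]])
      fix k assume "k \<in> {0..<d}"
      then have k: "k < d" by simp
      have "left_end (M ((\<lambda>k. w (s k)) ` {..<d})) k = w (s k)"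
        unfolding w_def by (rule sec) (use s k in auto)
      then show "left_end N k = left_end (M \<sigma>) k" using im s[OF k] by simp
    qed
  qed
  then have "compatible n d F (M \<sigma>)" if "dsubset n d \<sigma>" for \<sigma>
    using compatible_with_matching[OF M tope _ that] by blast
  moreover have "rdeg_vec d F = v"
    unfolding rdeg_vec_def F_def rdeg_graph_on using fibre vout by auto
  ultimately show thesis using that tope by blast
qed

lemma tope_eq_if_rdeg_vec_eq:
  assumes F: "maximal_tope n d F1" "maximal_tope n d F2" and c: "compatible n d F1 F2"
    and eq: "rdeg_vec d F1 = rdeg_vec d F2"
  shows "F1 = F2"
proof -
  obtain f where f: "F1 = graph_on {0..<n} f" "\<And>l. l < n \<Longrightarrow> f l < d"
    using maximal_tope_graph[OF F(1)] by metis
  obtain g where g: "F2 = graph_on {0..<n} g" "\<And>l. l < n \<Longrightarrow> g l < d"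
    using maximal_tope_graph[OF F(2)] by metis
  have card: "card {l \<in> {0..<n}. g l = r} = card {l \<in> {0..<n}. f l = r}" if "r < d" for r
    using fun_cong[OF eq, of r] that by (simp add: rdeg_vec_def f(1) g(1) rdeg_graph_on)
  have "g l = f l" if "l < n" for l
    by (rule compatible_fibre_mono[OF c, where S = "{0..<n}" and f = f])
      (use f g card that in auto)
  then show ?thesis using f(1) g(1) by (auto simp: graph_on_def)
qed

lemma tope_arrangement_of_linkage:
  assumes M: "linkage n d M"
  shows "tope_arrangement n d
    {F. maximal_tope n d F \<and> (\<forall>\<sigma>. dsubset n d \<sigma> \<longrightarrow> compatible n d F (M \<sigma>))}"
    (is "tope_arrangement n d ?A")
proof -
  have comp: "compatible n d F1 F2" if "F1 \<in> ?A" "F2 \<in> ?A" for F1 F2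
  proof (rule compatible_if_matchings_in_field[OF M])
    fix \<sigma> N assume \<sigma>: "dsubset n d \<sigma>" "perfect_matching \<sigma> {0..<d} N" "N \<subseteq> F1 \<or> N \<subseteq> F2"
    then show "N = M \<sigma>"
      using field_matching_if_compatible[OF \<sigma>(2) _ _ \<sigma>(1) linkage_matching[OF M \<sigma>(1)]] that by blast
  qed (use that in auto)
  have "inj_on (rdeg_vec d) ?A"
    using tope_eq_if_rdeg_vec_eq comp by (intro inj_onI) blast
  moreover have "rdeg_vec d ` ?A = pos_points n d"
  proof
    show "rdeg_vec d ` ?A \<subseteq> pos_points n d" using rdeg_vec_pos_points by blast
    show "pos_points n d \<subseteq> rdeg_vec d ` ?A"
    proof
      fix v assume "v \<in> pos_points n d"
      then obtain F where "maximal_tope n d F" "rdeg_vec d F = v"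
        "\<And>\<sigma>. dsubset n d \<sigma> \<Longrightarrow> compatible n d F (M \<sigma>)"
        using tope_of_degree_ex[OF M] by metis
      then show "v \<in> rdeg_vec d ` ?A" by blast
    qed
  qed
  ultimately have "bij_betw (rdeg_vec d) ?A (pos_points n d)" by (simp add: bij_betw_def)
  then show ?thesis unfolding tope_arrangement_def using comp by blast
qed

subsection \<open>From tope arrangements to linkage fields\<close>

text \<open>Deleting a left vertex from a tope arrangement: among the topes of types \<open>v + e\<^sub>i\<close> on
  \<open>insert x S\<close>, one has \<open>x\<close> attached to \<open>i\<close> itself; indeed if \<open>x\<close> is attached to \<open>j\<close> for
  some \<open>i\<close>, then it is attached to \<open>j\<close> for \<open>i = j\<close>.\<close>

lemma tope_of_type_on_subset:
  assumes A: "tope_arrangement n d A" and d: "1 \<le> d"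
    and S: "S \<subseteq> {0..<n}" and v: "\<And>i. i < d \<Longrightarrow> v i > 0" and sum: "(\<Sum>i<d. v i) = card S"
  shows "\<exists>F\<in>A. \<forall>r<d. card {l \<in> S. (l, r) \<in> F} = v r"
  using S v sum
proof (induction "card ({0..<n} - S)" arbitrary: S v)
  case 0
  then have S: "S = {0..<n}" by auto
  \<comment> \<open>Lattice points are functions that vanish from \<open>d\<close> on, hence the
    truncation.\<close>
  define u where "u i = (if i < d then v i else 0)" for i
  have "(\<Sum>i<d. u i) = (\<Sum>i<d. v i)" by (intro sum.cong) (auto simp: u_def)
  then have "u \<in> pos_points n d"
    using 0(3,4) S unfolding pos_points_def by (auto simp: u_def)
  moreover have "rdeg_vec d ` A = pos_points n d"
    using A unfolding tope_arrangement_def bij_betw_def by simp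
  ultimately have "u \<in> rdeg_vec d ` A" by simp
  then obtain F where F: "F \<in> A" "rdeg_vec d F = u" by blast
  then have "maximal_tope n d F" using A unfolding tope_arrangement_def by blast
  then have "F \<subseteq> {0..<n} \<times> {0..<d}" unfolding maximal_tope_def bgraph_def by simp
  then have "{l \<in> S. (l, r) \<in> F} = {l. (l, r) \<in> F}" for r unfolding S by auto
  then have "card {l \<in> S. (l, r) \<in> F} = v r" if "r < d" for r
    using fun_cong[OF F(2), of r] that by (simp add: rdeg_vec_def rdeg_def u_def)
  then show ?case using F(1) by blast
next
  case (Suc m)
  have finS: "finite S" using Suc.prems(1) finite_subset by auto
  have "{0..<n} - S \<noteq> {}" using Suc.hyps(2) by (metis card.empty nat.simps(3))
  then obtain x where "x \<in> {0..<n} - S" by blast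
  then have x: "x < n" "x \<notin> S" by auto
  let ?S = "insert x S"
  have S': "?S \<subseteq> {0..<n}" using x Suc.prems(1) by auto
  have "{0..<n} - ?S = {0..<n} - S - {x}" by auto
  then have m: "m = card ({0..<n} - ?S)" using Suc.hyps(2) x by simp
  have "\<exists>F\<in>A. \<forall>r<d. card {l \<in> ?S. (l, r) \<in> F} = (v(i := Suc (v i))) r" if i: "i < d" for i
  proof (rule Suc.hyps(1)[OF m S'])
    show "\<And>j. j < d \<Longrightarrow> (v(i := Suc (v i))) j > 0" using Suc.prems(2) by simp
    have "(\<Sum>j<d. (v(i := Suc (v i))) j) = Suc (v i) + (\<Sum>j\<in>{..<d} - {i}. (v(i := Suc (v i))) j)"
      using i by (simp add: sum.remove)
    also have "(\<Sum>j\<in>{..<d} - {i}. (v(i := Suc (v i))) j) = (\<Sum>j\<in>{..<d} - {i}. v j)"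
      by (intro sum.cong) auto
    also have "Suc (v i) + \<dots> = Suc (\<Sum>j<d. v j)" using i by (simp add: sum.remove)
    finally show "(\<Sum>j<d. (v(i := Suc (v i))) j) = card ?S" using Suc.prems(3) x(2) finS by simp
  qed
  then obtain F where F: "\<And>i. i < d \<Longrightarrow> F i \<in> A"
    and cF: "\<And>i r. \<lbrakk>i < d; r < d\<rbrakk> \<Longrightarrow> card {l \<in> ?S. (l, r) \<in> F i} = (v(i := Suc (v i))) r"
    by metis
  have "\<exists>f. F i = graph_on {0..<n} f \<and> (\<forall>l<n. f l < d)" if "i < d" for i
  proof -
    have "maximal_tope n d (F i)" using F[OF that] A unfolding tope_arrangement_def by blast
    then show ?thesis using maximal_tope_graph by metis
  qed
  then obtain f where f: "\<And>i. i < d \<Longrightarrow> F i = graph_on {0..<n} (f i)"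
    and fd: "\<And>i l. \<lbrakk>i < d; l < n\<rbrakk> \<Longrightarrow> f i l < d" by metis
  have mem: "(l, r) \<in> F i \<longleftrightarrow> f i l = r" if "i < d" "l \<in> ?S" for i l r
    using f[OF that(1)] S' that(2) by auto
  have card_f: "card {l \<in> ?S. f i l = r} = (v(i := Suc (v i))) r" if "i < d" "r < d" for i r
  proof -
    have "{l \<in> ?S. f i l = r} = {l \<in> ?S. (l, r) \<in> F i}" using mem[OF that(1)] by blast
    then show ?thesis using cF[OF that] by simp
  qed
  \<comment> \<open>Type 0 is an arbitrary start. From \<open>F 0\<close> to \<open>F j\<close> only
    the fibre of \<open>j\<close> can grow, so \<open>x\<close> stays attached to \<open>j\<close>,
    and deleting it from \<open>F j\<close> removes exactly the extra degree.\<close>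
  define j where "j = f 0 x"
  have j: "j < d" "0 < d" using fd[of 0 x] d x(1) by (auto simp: j_def)
  have "f j x = j"
  proof (rule compatible_fibre_mono[where ?F1.0 = "F 0" and ?F2.0 = "F j" and S = ?S and f = "f 0"
        and g = "f j" and l = x])
    show "compatible n d (F 0) (F j)"
      using A F[OF j(1)] F[OF j(2)] unfolding tope_arrangement_def by blast
    show "graph_on ?S (f 0) \<subseteq> F 0" "graph_on ?S (f j) \<subseteq> F j"
      unfolding f[OF j(1)] f[OF j(2)] using graph_on_mono[OF S'] by auto
    show "card {l \<in> ?S. f j l = r} \<le> card {l \<in> ?S. f 0 l = r}" if "r < d" "r \<noteq> j" for r
      unfolding card_f[OF j(1) that(1)] card_f[OF j(2) that(1)] using that(2) by simp
    show "?S \<subseteq> {0..<n}" by (fact S')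
    show "f 0 l < d" "f j l < d" if "l \<in> ?S" for l
      using fd[OF j(1), of l] fd[OF j(2), of l] S' that by auto
  qed (auto simp: j_def)
  have "card {l \<in> S. (l, r) \<in> F j} = v r" if r: "r < d" for r
  proof (cases "r = j")
    case True
    then have "{l \<in> ?S. (l, r) \<in> F j} = insert x {l \<in> S. (l, r) \<in> F j}"
      using mem[OF j(1), of x r] \<open>f j x = j\<close> by auto
    then have "Suc (card {l \<in> S. (l, r) \<in> F j}) = card {l \<in> ?S. (l, r) \<in> F j}"
      using x(2) finS by simp
    then show ?thesis using cF[OF j(1) r] True by simp
  next
    case False
    then have "{l \<in> ?S. (l, r) \<in> F j} = {l \<in> S. (l, r) \<in> F j}"
      using mem[OF j(1), of x r] \<open>f j x = j\<close> by auto
    then show ?thesis using cF[OF j(1) r] False by simp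
  qed
  then show ?case using F[OF j(1)] by blast
qed

lemma arrangement_matching_unique:
  assumes "tope_arrangement n d A" "dsubset n d \<sigma>"
    and "perfect_matching \<sigma> {0..<d} N" "F \<in> A" "N \<subseteq> F"
    and "perfect_matching \<sigma> {0..<d} N'" "F' \<in> A" "N' \<subseteq> F'"
  shows "N = N'"
proof -
  have "compatible n d F F'" using assms unfolding tope_arrangement_def by blast
  then show ?thesis using assms unfolding compatible_def dsubset_def by blast
qed

lemma perfect_matching_of_fibres:
  assumes "\<And>r. r < d \<Longrightarrow> card {l \<in> \<sigma>. f l = r} = 1" "\<And>l. l \<in> \<sigma> \<Longrightarrow> f l < d"
  shows "perfect_matching \<sigma> {0..<d} (graph_on \<sigma> f)"
proof -
  have ex: "\<exists>a. {l \<in> \<sigma>. f l = r} = {a}" if "r < d" for r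
    using assms(1)[OF that] by (simp add: card_1_singleton_iff)
  have "inj_on f \<sigma>"
  proof (rule inj_onI)
    fix x y assume xy: "x \<in> \<sigma>" "y \<in> \<sigma>" "f x = f y"
    obtain a where "{l \<in> \<sigma>. f l = f y} = {a}" using ex assms(2)[OF xy(2)] by blast
    moreover have "x \<in> {l \<in> \<sigma>. f l = f y}" "y \<in> {l \<in> \<sigma>. f l = f y}" using xy by auto
    ultimately show "x = y" by simp
  qed
  moreover have "f ` \<sigma> = {0..<d}"
  proof
    show "f ` \<sigma> \<subseteq> {0..<d}" using assms(2) by auto
    show "{0..<d} \<subseteq> f ` \<sigma>"
    proof
      fix r assume "r \<in> {0..<d}"
      then have "r < d" by simp
      then obtain a where "{l \<in> \<sigma>. f l = r} = {a}" using ex by blast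
      then have "a \<in> \<sigma>" "f a = r" by blast+
      then show "r \<in> f ` \<sigma>" by blast
    qed
  qed
  ultimately show ?thesis using perfect_matching_graph_on by metis
qed

lemma arrangement_matching_ex:
  assumes A: "tope_arrangement n d A" and d: "1 \<le> d" and \<sigma>: "dsubset n d \<sigma>"
  obtains N F where "perfect_matching \<sigma> {0..<d} N" "F \<in> A" "N \<subseteq> F"
proof -
  have "\<exists>F\<in>A. \<forall>r<d. card {l \<in> \<sigma>. (l, r) \<in> F} = 1"
    by (rule tope_of_type_on_subset[OF A d, where v = "\<lambda>_. 1"]) (use \<sigma> in \<open>auto simp: dsubset_def\<close>)
  then obtain F where F: "F \<in> A" "\<And>r. r < d \<Longrightarrow> card {l \<in> \<sigma>. (l, r) \<in> F} = 1" by blast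
  have "maximal_tope n d F" using F(1) A unfolding tope_arrangement_def by blast
  then obtain f where f: "F = graph_on {0..<n} f" "\<And>l. l < n \<Longrightarrow> f l < d"
    using maximal_tope_graph by metis
  have \<sigma>n: "\<sigma> \<subseteq> {0..<n}" using \<sigma> by (simp add: dsubset_def)
  have "{l \<in> \<sigma>. (l, r) \<in> F} = {l \<in> \<sigma>. f l = r}" for r using \<sigma>n f(1) by auto
  then have "perfect_matching \<sigma> {0..<d} (graph_on \<sigma> f)"
    using F(2) f(2) \<sigma>n by (intro perfect_matching_of_fibres) auto
  moreover have "graph_on \<sigma> f \<subseteq> F" using graph_on_mono[OF \<sigma>n] f(1) by simp
  ultimately show thesis using that F(1) by blast
qed

text \<open>On \<tau> some tope has degree two at \<open>i\<close> and one at the other right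
  vertices. Omitting either neighbour of \<open>i\<close> leaves a perfect matching, and the two
  matchings differ only at \<open>i\<close>.\<close>

lemma linkage_of_tope_arrangement:
  assumes A: "tope_arrangement n d A" and d: "1 \<le> d"
    and M: "\<And>\<sigma>. dsubset n d \<sigma> \<Longrightarrow> perfect_matching \<sigma> {0..<d} (M \<sigma>) \<and> (\<exists>F\<in>A. M \<sigma> \<subseteq> F)"
  shows "linkage n d M"
  unfolding linkage_def
proof (intro conjI allI impI)
  show "matching_field n d M" unfolding matching_field_def using M by blast
next
  fix i \<tau> assume i: "i < d" and \<tau>: "dsubset n (d + 1) \<tau>"
  have \<tau>n: "\<tau> \<subseteq> {0..<n}" "card \<tau> = Suc d" using \<tau> by (auto simp: dsubset_def)
  have fin: "finite \<tau>" using finite_subset[OF \<tau>n(1)] by simp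
  define v where "v = (\<lambda>r. if r = i then 2 else (1::nat))"
  have "(\<Sum>r<d. v r) = 2 + (\<Sum>r\<in>{..<d} - {i}. v r)"
    using i by (simp add: sum.remove v_def)
  also have "(\<Sum>r\<in>{..<d} - {i}. v r) = (\<Sum>r\<in>{..<d} - {i}. 1)"
    by (intro sum.cong) (auto simp: v_def)
  also have "\<dots> = d - 1" using i by simp
  finally have "(\<Sum>r<d. v r) = card \<tau>" using \<tau>n(2) d by simp
  moreover have "\<And>r. r < d \<Longrightarrow> v r > 0" by (simp add: v_def)
  ultimately have "\<exists>F\<in>A. \<forall>r<d. card {l \<in> \<tau>. (l, r) \<in> F} = v r"
    using tope_of_type_on_subset[OF A d \<tau>n(1), of v] by blast
  then obtain F where F: "F \<in> A" "\<And>r. r < d \<Longrightarrow> card {l \<in> \<tau>. (l, r) \<in> F} = v r" by blast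
  have "maximal_tope n d F" using F(1) A unfolding tope_arrangement_def by blast
  then obtain f where f: "F = graph_on {0..<n} f" "\<And>l. l < n \<Longrightarrow> f l < d"
    using maximal_tope_graph by metis
  have "{l \<in> \<tau>. (l, r) \<in> F} = {l \<in> \<tau>. f l = r}" for r using \<tau>n(1) f(1) by auto
  then have cf: "card {l \<in> \<tau>. f l = r} = v r" if "r < d" for r using F(2)[OF that] by simp
  have "card {l \<in> \<tau>. f l = i} = 2" using cf[OF i] by (simp add: v_def)
  then obtain a b where ab: "{l \<in> \<tau>. f l = i} = {a, b}" "a \<noteq> b" by (auto simp: card_2_iff)
  then have abT: "a \<in> \<tau>" "b \<in> \<tau>" "f a = i" "f b = i" by blast+
  \<comment> \<open>The matching left after omitting \<open>c\<close> lies in a tope of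
    \<open>A\<close>, so uniqueness identifies it with the given \<open>M\<close>.\<close>
  have M_eq: "M (\<tau> - {c}) = graph_on (\<tau> - {c}) f" if c: "c \<in> {a, b}" for c
  proof -
    have cT: "c \<in> \<tau>" "f c = i" using c abT by auto
    have sub: "\<tau> - {c} \<subseteq> {0..<n}" using \<tau>n(1) by auto
    have ds: "dsubset n d (\<tau> - {c})" using \<tau>n cT fin by (auto simp: dsubset_def)
    have "card {l \<in> \<tau> - {c}. f l = r} = 1" if r: "r < d" for r
    proof (cases "r = i")
      case True
      have "{l \<in> \<tau> - {c}. f l = r} = {l \<in> \<tau>. f l = i} - {c}" using True by auto
      then show ?thesis using ab c by auto
    next
      case False
      then have "{l \<in> \<tau> - {c}. f l = r} = {l \<in> \<tau>. f l = r}" using cT by auto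
      then show ?thesis using cf[OF r] False by (simp add: v_def)
    qed
    then have pm: "perfect_matching (\<tau> - {c}) {0..<d} (graph_on (\<tau> - {c}) f)"
      using f(2) sub by (intro perfect_matching_of_fibres) auto
    have "graph_on (\<tau> - {c}) f \<subseteq> F" using graph_on_mono[OF sub] f(1) by simp
    then show ?thesis
      using arrangement_matching_unique[OF A ds _ _ _ pm F(1)] M[OF ds] by blast
  qed
  have "{e \<in> M (\<tau> - {a}). snd e \<noteq> i} = {e \<in> M (\<tau> - {b}). snd e \<noteq> i}"
    using M_eq[of a] M_eq[of b] abT by (auto simp: graph_on_def)
  then show "\<exists>j\<in>\<tau>. \<exists>j'\<in>\<tau>. j \<noteq> j' \<and>
      {e \<in> M (\<tau> - {j}). snd e \<noteq> i} = {e \<in> M (\<tau> - {j'}). snd e \<noteq> i}"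
    using abT ab(2) by blast
qed

theorem theorem3p32:
  fixes n d :: nat
  assumes "d \<le> n" and "1 \<le> d"
  shows "(\<forall>M. linkage n d M \<longrightarrow>
            tope_arrangement n d
              {F. maximal_tope n d F \<and> (\<forall>\<sigma>. dsubset n d \<sigma> \<longrightarrow> compatible n d F (M \<sigma>))})
       \<and> (\<forall>A. tope_arrangement n d A \<longrightarrow>
            (\<forall>\<sigma>. dsubset n d \<sigma> \<longrightarrow>
               (\<exists>!M\<^sub>\<sigma>. perfect_matching \<sigma> {0..<d} M\<^sub>\<sigma> \<and> (\<exists>F\<in>A. M\<^sub>\<sigma> \<subseteq> F)))
          \<and> (\<forall>M. (\<forall>\<sigma>. dsubset n d \<sigma> \<longrightarrow>
                   perfect_matching \<sigma> {0..<d} (M \<sigma>) \<and> (\<exists>F\<in>A. M \<sigma> \<subseteq> F))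
                 \<longrightarrow> linkage n d M))"
proof (intro conjI allI impI)
  show "tope_arrangement n d
      {F. maximal_tope n d F \<and> (\<forall>\<sigma>. dsubset n d \<sigma> \<longrightarrow> compatible n d F (M \<sigma>))}"
    if "linkage n d M" for M
    using that by (rule tope_arrangement_of_linkage)
next
  fix A \<sigma> assume A: "tope_arrangement n d A" and \<sigma>: "dsubset n d \<sigma>"
  obtain N F where "perfect_matching \<sigma> {0..<d} N" "F \<in> A" "N \<subseteq> F"
    using arrangement_matching_ex[OF A assms(2) \<sigma>] .
  then show "\<exists>!N. perfect_matching \<sigma> {0..<d} N \<and> (\<exists>F\<in>A. N \<subseteq> F)"
    using arrangement_matching_unique[OF A \<sigma>] by blast
next
  fix A M assume "tope_arrangement n d A"
    and "\<forall>\<sigma>. dsubset n d \<sigma> \<longrightarrow> perfect_matching \<sigma> {0..<d} (M \<sigma>) \<and> (\<exists>F\<in>A. M \<sigma> \<subseteq> F)"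
  then show "linkage n d M" using linkage_of_tope_arrangement[OF _ assms(2)] by blast
qed

end
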